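(* The operator $\mathcal S_{\rm ref}$ of the discrete transparent boundary condition (defined in the context) satisfies the inequality $$\operatorname{Im}\sum_{m=1}^M\bigl(\mathcal S^m_{\rm ref}\boldsymbol\Phi^m,\overline s_t\Phi^m\bigr)_{\omega_\delta}\tau_m\ge 0\quad\text{for any } M\ge1,$$ for any function $\Phi:\overline\omega_\delta\times\overline\omega^{\,\tau}\to\mathbb C$ such that $\Phi^0=0$ and $\Phi|_{k=0,K}=0$, where $\boldsymbol\Phi^m=\{\Phi^1,\dots,\Phi^m\}$. Thus for the solution of the splitting in potential scheme with the discrete transparent boundary condition (i.e. the scheme described in the context with $\mathcal S=\mathcal S_{\rm ref}$), with initial data $\Psi^0_{\mathbf h}$ and perturbation $F^m$, the following stability bound holds: $$\max_{0\le m\le M}\|\sqrt{\rho_{\mathbf h}}\,\Psi^m\|_{\overline\omega_{\mathbf h}}\le\|\sqrt{\rho_{\mathbf h}}\,\Psi^0_{\mathbf h}\|_{\overline\omega_{\mathbf h}}+\frac{2}{\hbar}\sum_{m=1}^M\Bigl\|\frac{F^m}{\sqrt{\rho_{\mathbf h}}}\Bigr\|_{\overline\omega_{\mathbf h}}\tau_m\quad\text{for any } M\ge 1.$$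
   Context: **Coefficients.** $\Omega=(0,\infty)\times(0,Y)$, $\Omega_X=(0,X)\times(0,Y)$, $\hbar>0$ constant. Real functions $\rho(x,y)\ge\underline\rho>0$, $V(x,y)$ and a real symmetric matrix $\mathbf B=\{B_{pq}(x,y)\}_{p,q=1}^2$, positive definite uniformly in $\Omega$, are given, and $\psi^0(x,y)$ is a complex-valued initial function. For some $X_0>0$, on $\Omega\setminus\Omega_{X_0}$: $B_{11}=B_{1\infty}>0$, $B_{12}=B_{21}=0$, $B_{22}=B_{2\infty}>0$, $\rho=\rho_\infty>0$, $V=V_\infty$ (constants), $\psi^0=0$. A real auxiliary potential $\widetilde V(x)$ satisfies $\widetilde V(x)=V_\infty$ for $x\ge X_0$. **Meshes.** The time mesh $\overline\omega^{\,\tau}$ is uniform: $t_m=m\tau$, $m\ge0$, $\tau_m=\tau>0$. In $x$: nodes $0=x_0<\dots<x_J=X<\dots$ on $[0,\infty)$, where $X>X_0$, with $h_j=x_j-x_{j-1}$, $x_{J-2}\ge X_0$, $h_j=h:=h_J$ for $j\ge J$; $h_{j+1/2}=\frac{h_j+h_{j+1}}2$; $\overline\omega_h=\{x_j\}_{j=0}^J$, $\omega_h=\{x_j\}_{j=1}^{J-1}$. In $y$: $\overline\omega_\delta$ with nodes $0=y_0<\dots<y_K=Y$, $\delta_k=y_k-y_{k-1}$, $\delta_{k+1/2}=\frac{\delta_k+\delta_{k+1}}2$, $\omega_\delta=\{y_k\}_{k=1}^{K-1}$. $\overline\omega_{\mathbf h}=\overline\omega_h\times\overline\omega_\delta$,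 $\omega_{\mathbf h}=\omega_h\times\omega_\delta$, $\Gamma_{\mathbf h}=\{(0,y_k):1\le k\le K-1\}\cup\{(x_j,0),(x_j,Y):0\le j\le J\}$. **Mesh operators.** $\overline\partial_xW_j=\frac{W_j-W_{j-1}}{h_j}$, $\widehat\partial_xW_j=\frac{W_{j+1}-W_j}{h_{j+1/2}}$, $\overset{\circ}{\partial}_xW_j=\frac{W_{j+1}-W_{j-1}}{2h_{j+1/2}}$, $\overline s_xW_j=\frac{W_{j-1}+W_j}2$, $\widehat s_xW_j=\frac{h_jW_j+h_{j+1}W_{j+1}}{2h_{j+1/2}}$; $\overline\partial_y,\widehat\partial_y,\overline s_y,\widehat s_y$ are defined likewise in the index $k$ with steps $\delta_k,\delta_{k+1/2}$. $\overline\partial_t\Phi^m=\frac{\Phi^m-\Phi^{m-1}}{\tau_m}$, $\overline s_t\Phi^m=\frac{\Phi^{m-1}+\Phi^m}2$. **Discrete coefficients.** $A_{-,jk}=A(\frac{x_{j-1}+x_j}2,\frac{y_{k-1}+y_k}2)$ for $A=\rho,B_{pq},V$ and $\widetilde V_{-,j}=\widetilde V(\frac{x_{j-1}+x_j}2)$; $B_{11\mathbf h}=\widehat s_yB_{11,-}$, $B_{22\mathbf h}=\widehat s_xB_{22,-}$, $B_{12\mathbf h}=B_{21\mathbf h}=B_{12,-}$, $\rho_{\mathbf h}=\widehat s_x\widehat s_y\rho_-$, $V_{\mathbf h}=\widehat s_x\widehat s_yV_-$, $\widetilde V_h=\widehat s_x\widetilde V_-$, $\Delta V_{\mathbf h}=V_{\mathbf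 h}-\widetilde V_h$. The mesh Hamiltonian is $$\mathcal H_{0\mathbf h}W=-\tfrac{\hbar^2}2\bigl[\widehat\partial_x(B_{11\mathbf h}\overline\partial_xW)+\widehat\partial_x\widehat s_y(B_{12\mathbf h}\overline s_x\overline\partial_yW)+\widehat s_x\widehat\partial_y(B_{21\mathbf h}\overline\partial_x\overline s_yW)+\widehat\partial_y(B_{22\mathbf h}\overline\partial_yW)\bigr].$$ **Inner products and norms.** $(U,W)_{\omega_\delta}=\sum_{k=1}^{K-1}U_kW_k^*\delta_{k+1/2}$ with norm $\|\cdot\|_{\omega_\delta}$; $(U,W)_{\overline\omega_{\mathbf h}}=\sum_{j=1}^{J-1}\sum_{k=1}^{K-1}U_{jk}W_{jk}^*h_{j+1/2}\delta_{k+1/2}+\sum_{k=1}^{K-1}U_{Jk}W_{Jk}^*\frac h2\delta_{k+1/2}$, with associated norm $\|\cdot\|_{\overline\omega_{\mathbf h}}$ ($*$ is complex conjugation). **Operator $\mathcal S_{\rm ref}$ of the discrete transparent boundary condition.** Given $\Phi^m:\overline\omega_\delta\to\mathbb C$, $m\ge0$, with $\Phi^0=0$ and $\Phi^m|_{k=0,K}=0$, let $U^m$, $m\ge0$, be the mesh functions on $\{x_j\}_{j\ge J-1}\times\overline\omega_\delta$ with $\sum_{j\ge J-1}\|U^m_{j\cdot}\|^2_{\omega_\delta}<\infty$ that solve, for all $m\ge1$, $$i\hbar\rho_\infty\overline\partial_tU^m=\Bigl[-\tfrac{\hbar^2}2\bigl(B_{1\infty}\widehat\partial_x\overline\partial_x+B_{2\infty}\widehat\partial_y\overline\partial_y\bigr)+V_\infty\Bigr]\overline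 s_tU^m\quad\text{on }\{x_j\}_{j\ge J}\times\omega_\delta,$$ $U^m|_{k=0,K}=0$, $U^0=0$, and $U^m_{J\cdot}=\Phi^m$. Then $$\mathcal S^m_{\rm ref}\boldsymbol\Phi^m:=\bigl(\overset{\circ}{\partial}_x\overline s_tU^m\bigr)\big|_{j=J}\ \text{ on }\omega_\delta,\qquad \boldsymbol\Phi^m=\{\Phi^1,\dots,\Phi^m\},\ m\ge1.$$ **Scheme.** Given $F^m:\overline\omega_{\mathbf h}\to\mathbb C$ with $F^m|_{\Gamma_{\mathbf h}}=0$ and $\Psi^0_{\mathbf h}$ with $(\Psi^0_{\mathbf h})_{jk}=\psi^0(x_j,y_k)$, where it is assumed that $\Psi^0_{\mathbf h}|_{j=J}=\Psi^0_{\mathbf h}|_{j=J-1}=0$ and $\Psi^0_{\mathbf h}|_{\Gamma_{\mathbf h}}=0$, the splitting in potential scheme is to find $\Psi^0=\Psi^0_{\mathbf h}$ and, for all $m\ge1$, functions $\breve\Psi^m,\widetilde\Psi^m,\Psi^m$ on $\overline\omega_{\mathbf h}$, vanishing on $\Gamma_{\mathbf h}$, with: (i) $\breve\Psi^m=\mathcal E^m\Psi^{m-1}$ and (iii) $\Psi^m=\mathcal E^m\widetilde\Psi^m$ on $(\omega_h\cup\{x_J\})\times\omega_\delta$, where either $\mathcal E^m=\dfrac{1-i\frac{\tau_m}{4\hbar\rho_{\mathbf h}}\Delta V_{\mathbf h}}{1+i\frac{\tau_m}{4\hbar\rho_{\mathbf h}}\Delta V_{\mathbf h}}$ (equivalently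 $i\hbar\rho_{\mathbf h}\frac{\breve\Psi^m-\Psi^{m-1}}{\tau_m/2}=\Delta V_{\mathbf h}\frac{\breve\Psi^m+\Psi^{m-1}}2$ and $i\hbar\rho_{\mathbf h}\frac{\Psi^m-\widetilde\Psi^m}{\tau_m/2}=\Delta V_{\mathbf h}\frac{\Psi^m+\widetilde\Psi^m}2$), or $\mathcal E^m=\exp\{-i\frac{\tau_m}{2\hbar\rho_{\mathbf h}}\Delta V_{\mathbf h}\}$ (both choices are admitted); (ii) $i\hbar\rho_{\mathbf h}\dfrac{\widetilde\Psi^m-\breve\Psi^m}{\tau_m}=(\mathcal H_{0\mathbf h}+\widetilde V_h)\dfrac{\widetilde\Psi^m+\breve\Psi^m}2+F^m$ on $\omega_{\mathbf h}$; (iv) on $\omega_\delta$, with $\mathcal S^m=\mathcal S^m_{\rm ref}$, $$\Bigl\{\tfrac{\hbar^2}2B_{1\infty}\overline\partial_x\tfrac{\widetilde\Psi^m+\breve\Psi^m}2-\tfrac h2\Bigl[i\hbar\rho_\infty\tfrac{\widetilde\Psi^m-\breve\Psi^m}{\tau_m}+\bigl(\tfrac{\hbar^2}2B_{2\infty}\widehat\partial_y\overline\partial_y-V_\infty\bigr)\tfrac{\widetilde\Psi^m+\breve\Psi^m}2\Bigr]\Bigr\}\Big|_{j=J}+\tfrac h2F^m|_{j=J}=\tfrac{\hbar^2}2B_{1\infty}\mathcal S^m\widetilde{\boldsymbol\Psi}^m_J,$$ where $\widetilde{\boldsymbol\Psi}^m_J=\{\widetilde\Psi^1_{J\cdot},\dots,\widetilde\Psi^m_{J\cdot}\}$.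 *)

theory Defs
  imports "HOL-Analysis.Analysis"
begin

text \<open>
  A one-dimensional mesh is given by its sequence of nodes \<open>z\<close>, a mesh function by a function of
  the index. All operators below are meant at indices \<open>n \<ge> 1\<close>.
\<close>

definition mesh_step :: "(nat \<Rightarrow> real) \<Rightarrow> nat \<Rightarrow> real" where
  "mesh_step z n = z n - z (n - 1)"

definition mid_step :: "(nat \<Rightarrow> real) \<Rightarrow> nat \<Rightarrow> real" where
  "mid_step z n = (mesh_step z n + mesh_step z (n + 1)) / 2"

definition dbar :: "(nat \<Rightarrow> real) \<Rightarrow> (nat \<Rightarrow> 'a::real_field) \<Rightarrow> nat \<Rightarrow> 'a" where
  "dbar z w n = (w n - w (n - 1)) / of_real (mesh_step z n)"

definition dhat :: "(nat \<Rightarrow> real) \<Rightarrow> (nat \<Rightarrow> 'a::real_field) \<Rightarrow> nat \<Rightarrow> 'a" where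
  "dhat z w n = (w (n + 1) - w n) / of_real (mid_step z n)"

definition dcirc :: "(nat \<Rightarrow> real) \<Rightarrow> (nat \<Rightarrow> 'a::real_field) \<Rightarrow> nat \<Rightarrow> 'a" where
  "dcirc z w n = (w (n + 1) - w (n - 1)) / of_real (2 * mid_step z n)"

definition sbar :: "(nat \<Rightarrow> 'a::real_field) \<Rightarrow> nat \<Rightarrow> 'a" where
  "sbar w n = (w (n - 1) + w n) / 2"

definition shat :: "(nat \<Rightarrow> real) \<Rightarrow> (nat \<Rightarrow> 'a::real_field) \<Rightarrow> nat \<Rightarrow> 'a" where
  "shat z w n = (of_real (mesh_step z n) * w n + of_real (mesh_step z (n + 1)) * w (n + 1))
                / of_real (2 * mid_step z n)"

definition along_x :: "((nat \<Rightarrow> 'a) \<Rightarrow> nat \<Rightarrow> 'b) \<Rightarrow> (nat \<Rightarrow> nat \<Rightarrow> 'a) \<Rightarrow> nat \<Rightarrow> nat \<Rightarrow> 'b" where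
  "along_x D W j k = D (\<lambda>i. W i k) j"

definition along_y :: "((nat \<Rightarrow> 'a) \<Rightarrow> nat \<Rightarrow> 'b) \<Rightarrow> (nat \<Rightarrow> nat \<Rightarrow> 'a) \<Rightarrow> nat \<Rightarrow> nat \<Rightarrow> 'b" where
  "along_y D W j k = D (W j) k"

text \<open>\<open>sbar x j\<close> is the midpoint of the cell \<open>[x (j - 1), x j]\<close>.\<close>

definition at_cells ::
  "(nat \<Rightarrow> real) \<Rightarrow> (nat \<Rightarrow> real) \<Rightarrow> (real \<Rightarrow> real \<Rightarrow> real) \<Rightarrow> nat \<Rightarrow> nat \<Rightarrow> real" where
  "at_cells x y A j k = A (sbar x j) (sbar y k)"

definition at_nodes ::
  "(nat \<Rightarrow> real) \<Rightarrow> (nat \<Rightarrow> real) \<Rightarrow> (real \<Rightarrow> real \<Rightarrow> real) \<Rightarrow> nat \<Rightarrow> nat \<Rightarrow> real" where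
  "at_nodes x y A = along_x (shat x) (along_y (shat y) (at_cells x y A))"

definition at_nodes_1d :: "(nat \<Rightarrow> real) \<Rightarrow> (real \<Rightarrow> real) \<Rightarrow> nat \<Rightarrow> real" where
  "at_nodes_1d x A = shat x (\<lambda>j. A (sbar x j))"

definition delta_V ::
  "(nat \<Rightarrow> real) \<Rightarrow> (nat \<Rightarrow> real) \<Rightarrow> (real \<Rightarrow> real \<Rightarrow> real) \<Rightarrow> (real \<Rightarrow> real) \<Rightarrow> nat \<Rightarrow> nat \<Rightarrow> real" where
  "delta_V x y V Vt j k = at_nodes x y V j k - at_nodes_1d x Vt j"

definition mesh_H0 ::
  "real \<Rightarrow> (nat \<Rightarrow> real) \<Rightarrow> (nat \<Rightarrow> real) \<Rightarrow> (real \<Rightarrow> real \<Rightarrow> real^2^2)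
    \<Rightarrow> (nat \<Rightarrow> nat \<Rightarrow> complex) \<Rightarrow> nat \<Rightarrow> nat \<Rightarrow> complex" where
  "mesh_H0 hbar x y B W j k =
    (let B_cell = (\<lambda>p q. at_cells x y (\<lambda>s t. B s t $ p $ q));
         B11 = along_y (shat y) (B_cell 1 1);
         B12 = B_cell 1 2;
         B21 = B_cell 2 1;
         B22 = along_x (shat x) (B_cell 2 2)
     in - of_real (hbar\<^sup>2 / 2) *
         (along_x (dhat x) (\<lambda>i l. of_real (B11 i l) * along_x (dbar x) W i l) j k
        + along_x (dhat x) (along_y (shat y)
            (\<lambda>i l. of_real (B12 i l) * along_x sbar (along_y (dbar y) W) i l)) j k
        + along_x (shat x) (along_y (dhat y)
            (\<lambda>i l. of_real (B21 i l) * along_x (dbar x) (along_y sbar W) i l)) j k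
        + along_y (dhat y) (\<lambda>i l. of_real (B22 i l) * along_y (dbar y) W i l) j k))"

definition inner_y ::
  "(nat \<Rightarrow> real) \<Rightarrow> nat \<Rightarrow> (nat \<Rightarrow> complex) \<Rightarrow> (nat \<Rightarrow> complex) \<Rightarrow> complex" where
  "inner_y y K U W = (\<Sum>k = 1..<K. U k * cnj (W k) * of_real (mid_step y k))"

definition norm_y :: "(nat \<Rightarrow> real) \<Rightarrow> nat \<Rightarrow> (nat \<Rightarrow> complex) \<Rightarrow> real" where
  "norm_y y K U = sqrt (Re (inner_y y K U U))"

definition inner_xy ::
  "(nat \<Rightarrow> real) \<Rightarrow> nat \<Rightarrow> (nat \<Rightarrow> real) \<Rightarrow> nat
    \<Rightarrow> (nat \<Rightarrow> nat \<Rightarrow> complex) \<Rightarrow> (nat \<Rightarrow> nat \<Rightarrow> complex) \<Rightarrow> complex" where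
  "inner_xy x J y K U W =
     (\<Sum>j = 1..<J. \<Sum>k = 1..<K. U j k * cnj (W j k) * of_real (mid_step x j * mid_step y k))
     + (\<Sum>k = 1..<K. U J k * cnj (W J k) * of_real (mesh_step x J / 2 * mid_step y k))"

definition norm_xy ::
  "(nat \<Rightarrow> real) \<Rightarrow> nat \<Rightarrow> (nat \<Rightarrow> real) \<Rightarrow> nat \<Rightarrow> (nat \<Rightarrow> nat \<Rightarrow> complex) \<Rightarrow> real" where
  "norm_xy x J y K U = sqrt (Re (inner_xy x J y K U U))"

text \<open>
  Arguments of functions of time and space are ordered as \<open>U m j k\<close>: time level, index in \<open>x\<close>,
  index in \<open>y\<close>. Only the values with \<open>j \<ge> J - 1\<close> and \<open>k \<le> K\<close> matter in \<open>exterior_solution\<close>.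
\<close>

definition exterior_solution ::
  "real \<Rightarrow> real \<Rightarrow> real \<Rightarrow> real \<Rightarrow> real \<Rightarrow> real \<Rightarrow> (nat \<Rightarrow> real) \<Rightarrow> nat \<Rightarrow> (nat \<Rightarrow> real) \<Rightarrow> nat
    \<Rightarrow> (nat \<Rightarrow> nat \<Rightarrow> complex) \<Rightarrow> (nat \<Rightarrow> nat \<Rightarrow> nat \<Rightarrow> complex) \<Rightarrow> bool" where
  "exterior_solution hbar \<tau> \<rho>_inf B1_inf B2_inf V_inf x J y K \<Phi> U \<longleftrightarrow>
     (\<forall>m. summable (\<lambda>j. (norm_y y K (U m (J - 1 + j)))\<^sup>2)) \<and>
     (\<forall>m\<ge>1. \<forall>j\<ge>J. \<forall>k\<in>{1..<K}.
        (let W = (\<lambda>i l. sbar (\<lambda>n. U n i l) m)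
         in \<i> * of_real (hbar * \<rho>_inf) * ((U m j k - U (m - 1) j k) / of_real \<tau>) =
            - of_real (hbar\<^sup>2 / 2) *
                (of_real B1_inf * along_x (dhat x) (along_x (dbar x) W) j k
               + of_real B2_inf * along_y (dhat y) (along_y (dbar y) W) j k)
            + of_real V_inf * W j k)) \<and>
     (\<forall>m. \<forall>j\<ge>J - 1. U m j 0 = 0 \<and> U m j K = 0) \<and>
     (\<forall>j\<ge>J - 1. \<forall>k\<le>K. U 0 j k = 0) \<and>
     (\<forall>m\<ge>1. \<forall>k\<le>K. U m J k = \<Phi> m k)"

text \<open>
  The boundary data at time level 0 are not used by \<open>exterior_solution\<close>, so \<open>S_ref\<close> only depends on
  \<open>\<Phi> 1, \<Phi> 2, \<dots>\<close>. The description operator selects the value at \<open>(m, k)\<close> rather than the solution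
  \<open>U\<close>, which is unconstrained outside its mesh.
\<close>

definition S_ref ::
  "real \<Rightarrow> real \<Rightarrow> real \<Rightarrow> real \<Rightarrow> real \<Rightarrow> real \<Rightarrow> (nat \<Rightarrow> real) \<Rightarrow> nat \<Rightarrow> (nat \<Rightarrow> real) \<Rightarrow> nat
    \<Rightarrow> (nat \<Rightarrow> nat \<Rightarrow> complex) \<Rightarrow> nat \<Rightarrow> nat \<Rightarrow> complex" where
  "S_ref hbar \<tau> \<rho>_inf B1_inf B2_inf V_inf x J y K \<Phi> m k =
     (THE s. \<exists>U. exterior_solution hbar \<tau> \<rho>_inf B1_inf B2_inf V_inf x J y K \<Phi> U \<and>
                 s = dcirc x (\<lambda>j. sbar (\<lambda>n. U n j k) m) J)"

definition vanishes_on_Gamma :: "nat \<Rightarrow> nat \<Rightarrow> (nat \<Rightarrow> nat \<Rightarrow> complex) \<Rightarrow> bool" where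
  "vanishes_on_Gamma J K W \<longleftrightarrow>
     (\<forall>k\<in>{1..<K}. W 0 k = 0) \<and> (\<forall>j\<le>J. W j 0 = 0 \<and> W j K = 0)"

definition cayley_factor :: "real \<Rightarrow> real \<Rightarrow> real \<Rightarrow> real \<Rightarrow> complex" where
  "cayley_factor hbar \<tau> r dV =
     (1 - \<i> * of_real (\<tau> / (4 * hbar * r) * dV)) / (1 + \<i> * of_real (\<tau> / (4 * hbar * r) * dV))"

definition exp_factor :: "real \<Rightarrow> real \<Rightarrow> real \<Rightarrow> real \<Rightarrow> complex" where
  "exp_factor hbar \<tau> r dV = exp (- \<i> * of_real (\<tau> / (2 * hbar * r) * dV))"

text \<open>
  \<open>\<Psi>b\<close> and \<open>\<Psi>t\<close> are the intermediate functions after the first potential half-step and after the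
  Hamiltonian step; \<open>S\<close> is the boundary operator, \<open>E m\<close> the factor of the potential half-steps.
\<close>

definition splitting_scheme ::
  "real \<Rightarrow> real \<Rightarrow> (nat \<Rightarrow> real) \<Rightarrow> nat \<Rightarrow> (nat \<Rightarrow> real) \<Rightarrow> nat
    \<Rightarrow> (real \<Rightarrow> real \<Rightarrow> real) \<Rightarrow> (real \<Rightarrow> real \<Rightarrow> real^2^2) \<Rightarrow> (real \<Rightarrow> real \<Rightarrow> real) \<Rightarrow> (real \<Rightarrow> real)
    \<Rightarrow> real \<Rightarrow> real \<Rightarrow> real \<Rightarrow> real
    \<Rightarrow> ((nat \<Rightarrow> nat \<Rightarrow> complex) \<Rightarrow> nat \<Rightarrow> nat \<Rightarrow> complex)
    \<Rightarrow> (nat \<Rightarrow> nat \<Rightarrow> complex) \<Rightarrow> (nat \<Rightarrow> nat \<Rightarrow> nat \<Rightarrow> complex)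
    \<Rightarrow> (nat \<Rightarrow> nat \<Rightarrow> nat \<Rightarrow> complex) \<Rightarrow> (nat \<Rightarrow> nat \<Rightarrow> nat \<Rightarrow> complex) \<Rightarrow> (nat \<Rightarrow> nat \<Rightarrow> nat \<Rightarrow> complex)
    \<Rightarrow> (nat \<Rightarrow> nat \<Rightarrow> nat \<Rightarrow> complex) \<Rightarrow> bool" where
  "splitting_scheme hbar \<tau> x J y K \<rho> B V Vt \<rho>_inf B1_inf B2_inf V_inf S \<Psi>0 F E \<Psi>b \<Psi>t \<Psi> \<longleftrightarrow>
     (\<forall>j\<le>J. \<forall>k\<le>K. \<Psi> 0 j k = \<Psi>0 j k) \<and>
     (\<forall>m\<ge>1.
        (let A = (\<lambda>j k. (\<Psi>t m j k + \<Psi>b m j k) / 2);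
             D = (\<lambda>j k. (\<Psi>t m j k - \<Psi>b m j k) / of_real \<tau>);
             h = mesh_step x J
         in
         vanishes_on_Gamma J K (\<Psi>b m) \<and> vanishes_on_Gamma J K (\<Psi>t m) \<and>
         vanishes_on_Gamma J K (\<Psi> m) \<and>
         (\<forall>j\<in>{1..J}. \<forall>k\<in>{1..<K}. \<Psi>b m j k = E m j k * \<Psi> (m - 1) j k) \<and>
         (\<forall>j\<in>{1..<J}. \<forall>k\<in>{1..<K}.
            \<i> * of_real (hbar * at_nodes x y \<rho> j k) * D j k =
            mesh_H0 hbar x y B A j k + of_real (at_nodes_1d x Vt j) * A j k + F m j k) \<and>
         (\<forall>j\<in>{1..J}. \<forall>k\<in>{1..<K}. \<Psi> m j k = E m j k * \<Psi>t m j k) \<and>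
         (\<forall>k\<in>{1..<K}.
            of_real (hbar\<^sup>2 / 2 * B1_inf) * along_x (dbar x) A J k
            - of_real (h / 2) *
                (\<i> * of_real (hbar * \<rho>_inf) * D J k
                 + (of_real (hbar\<^sup>2 / 2 * B2_inf) * along_y (dhat y) (along_y (dbar y) A) J k
                    - of_real V_inf * A J k))
            + of_real (h / 2) * F m J k =
            of_real (hbar\<^sup>2 / 2 * B1_inf) * S (\<lambda>n. \<Psi>t n J) m k)))"

end

theory Submission
  imports Defs
begin

text \<open>
  Both parts rest on one conservation law. Let \<open>U\<close> solve the exterior problem, let \<open>W\<close> be its mean
  over a time step and \<open>\<kappa> = hbar\<^sup>2 B1_inf / (2 h\<^sup>2)\<close>. Pairing the equation in column \<open>j\<close> with \<open>W j\<close> over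
  the cross-section and taking imaginary parts kills the potential and the second difference in \<open>y\<close>,
  and the second difference in \<open>x\<close> leaves a difference of fluxes \<open>\<phi> j = Im (W (j + 1), W j)\<close>:
  \<open>\<parallel>U m j\<parallel>\<^sup>2 - \<parallel>U (m - 1) j\<parallel>\<^sup>2\<close> is proportional to \<open>\<phi> (j - 1) - \<phi> j\<close>. Fluxes of square-summable functions
  tend to zero, so summation over \<open>j > J\<close> shows that \<open>\<phi> J\<close> is the rate at which mass enters the
  exterior (\<open>exterior_mass_balance\<close>). The central difference in the definition of \<open>S_ref\<close> gives
  \<open>2 h Im (S, W J) = \<phi> J + \<phi> (J - 1) = 2 \<phi> J + (\<phi> (J - 1) - \<phi> J)\<close>, which is therefore the rate of growth
  of twice the mass beyond \<open>x J\<close> plus the mass on \<open>x J\<close> (\<open>exterior_flux_balance\<close>). That quantity is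
  nonnegative and starts at zero; this is the dissipativity of \<open>S_ref\<close>.

  As \<open>S_ref\<close> is a description, the exterior problem has to be shown to determine its value. Two
  solutions with the same boundary data differ by one with \<open>\<phi> J = 0\<close>, whose mass stays zero
  (\<open>exterior_zero_data\<close>). Existence amounts, in each time step, to solving \<open>(\<i> \<alpha> - H) w = G\<close> on a
  half-line, where \<open>H\<close> is bounded and, again by the flux identity, symmetric under a zero boundary
  condition. For small \<open>\<epsilon> > 0\<close> the operator \<open>(1 - \<epsilon> \<alpha>) - \<i> \<epsilon> H\<close> is then a contraction of the
  energy, and a Neumann series gives the solution (\<open>half_line_resolvent\<close>).

  For the scheme, the potential half-steps multiply by numbers of modulus one. Summation by parts
  shows that the Hamiltonian step preserves the mass of the interior up to the forcing and the flux
  through the last column; the boundary condition accounts for the half cell at \<open>x J\<close> and replaces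
  that flux by a negative multiple of \<open>Im (S, W J)\<close> (\<open>hamiltonian_step_energy\<close>). In the last column the potential half-steps are
  trivial, so \<open>W J\<close> is the time mean of the boundary data of \<open>S_ref\<close>, and dissipativity removes the
  boundary contribution after summation over the time levels. What is left is a quadratic inequality
  between norms, which \<open>discrete_gronwall\<close> resolves.
\<close>

section \<open>Weighted sums of squares\<close>

text \<open>  The norms over the cross-section and over the whole mesh are both of this kind, so that the
  triangle and Cauchy-Schwarz inequalities need only one proof.\<close>

definition weighted_norm :: "'p set \<Rightarrow> ('p \<Rightarrow> real) \<Rightarrow> ('p \<Rightarrow> complex) \<Rightarrow> real" where
  "weighted_norm P w u = L2_set (\<lambda>p. sqrt (w p) * cmod (u p)) P"

lemma weighted_norm_nonneg [simp]: "0 \<le> weighted_norm P w u"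
  by (simp add: weighted_norm_def L2_set_nonneg)

lemma weighted_norm_cong:
  "(\<And>p. p \<in> P \<Longrightarrow> cmod (u p) = cmod (v p)) \<Longrightarrow> weighted_norm P w u = weighted_norm P w v"
  by (simp add: weighted_norm_def cong: L2_set_cong)

lemma weighted_norm_power2:
  assumes "\<And>p. p \<in> P \<Longrightarrow> 0 \<le> w p"
  shows "(weighted_norm P w u)\<^sup>2 = (\<Sum>p\<in>P. w p * (cmod (u p))\<^sup>2)"
  using assms
  by (auto simp: weighted_norm_def L2_set_def sum_nonneg power_mult_distrib intro!: sum.cong)

lemma weighted_norm_triangle:
  assumes "\<And>p. p \<in> P \<Longrightarrow> 0 \<le> w p"
  shows "weighted_norm P w (\<lambda>p. u p + v p) \<le> weighted_norm P w u + weighted_norm P w v"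
proof -
  have "weighted_norm P w (\<lambda>p. u p + v p)
      \<le> L2_set (\<lambda>p. sqrt (w p) * cmod (u p) + sqrt (w p) * cmod (v p)) P"
    unfolding weighted_norm_def using assms
    by (intro L2_set_mono)
       (auto simp: distrib_left[symmetric] intro!: mult_left_mono norm_triangle_ineq)
  also have "\<dots> \<le> weighted_norm P w u + weighted_norm P w v"
    unfolding weighted_norm_def by (rule L2_set_triangle_ineq)
  finally show ?thesis .
qed

lemma weighted_norm_scale:
  "weighted_norm P w (\<lambda>p. c * u p) = cmod c * weighted_norm P w u"
  unfolding weighted_norm_def
  by (subst L2_set_right_distrib) (auto simp: norm_mult mult_ac intro!: L2_set_cong)

lemma weighted_norm_Cauchy_Schwarz:
  assumes "\<And>p. p \<in> P \<Longrightarrow> 0 \<le> w p"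
  shows "cmod (\<Sum>p\<in>P. u p * cnj (v p) * of_real (w p)) \<le> weighted_norm P w u * weighted_norm P w v"
proof -
  have "cmod (\<Sum>p\<in>P. u p * cnj (v p) * of_real (w p))
      \<le> (\<Sum>p\<in>P. \<bar>sqrt (w p) * cmod (u p)\<bar> * \<bar>sqrt (w p) * cmod (v p)\<bar>)"
  proof (intro sum_norm_le)
    fix p assume "p \<in> P"
    then have "0 \<le> w p" by (rule assms)
    then have "cmod (u p * cnj (v p) * of_real (w p))
        = (sqrt (w p) * cmod (u p)) * (sqrt (w p) * cmod (v p))"
      using real_sqrt_mult_self[of "w p"] by (simp add: norm_mult)
    then show "cmod (u p * cnj (v p) * of_real (w p))
        \<le> \<bar>sqrt (w p) * cmod (u p)\<bar> * \<bar>sqrt (w p) * cmod (v p)\<bar>"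
      using \<open>0 \<le> w p\<close> by simp
  qed
  also have "\<dots> \<le> weighted_norm P w u * weighted_norm P w v"
    unfolding weighted_norm_def by (rule L2_set_mult_ineq)
  finally show ?thesis .
qed

lemma Re_mult_cnj_self: "Re (z * cnj z * of_real r) = r * (cmod z)\<^sup>2"
  by (simp only: complex_norm_square[symmetric] mult.commute flip: of_real_mult) simp

lemma Re_diff_mult_cnj_mean:
  "Re ((u - v) * cnj ((u + v) / 2)) = ((cmod u)\<^sup>2 - (cmod v)\<^sup>2) / 2"
  unfolding cmod_power2 by (simp add: field_simps power2_eq_square)

lemma summation_by_parts:
  fixes g a :: "nat \<Rightarrow> 'a::comm_ring_1"
  assumes "a 0 = 0" "1 \<le> N"
  shows "(\<Sum>j = 1..<N. (g (j + 1) - g j) * a j) = g N * a N - (\<Sum>j = 1..N. g j * (a j - a (j - 1)))"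
  using assms(2)
proof (induction N rule: dec_induct)
  case base
  then show ?case using assms(1) by simp
next
  case (step n)
  then show ?case by (simp add: algebra_simps)
qed

section \<open>The cross-section\<close>

locale cross_section =
  fixes y :: "nat \<Rightarrow> real" and K :: nat
  assumes mono: "strict_mono_on {0..K} y" and K_pos: "1 \<le> K"
begin

abbreviation nrm :: "(nat \<Rightarrow> complex) \<Rightarrow> real" where "nrm \<equiv> norm_y y K"
abbreviation ip :: "(nat \<Rightarrow> complex) \<Rightarrow> (nat \<Rightarrow> complex) \<Rightarrow> complex" where "ip \<equiv> inner_y y K"

lemma step_pos: "1 \<le> k \<Longrightarrow> k \<le> K \<Longrightarrow> 0 < mesh_step y k"
  using strict_mono_onD[OF mono, of "k - 1" k] by (simp add: mesh_step_def)

lemma mid_pos: "k \<in> {1..<K} \<Longrightarrow> 0 < mid_step y k"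
  using step_pos[of k] step_pos[of "k + 1"] by (simp add: mid_step_def)

lemma mid_nonneg: "k \<in> {1..<K} \<Longrightarrow> 0 \<le> mid_step y k"
  using mid_pos less_imp_le by blast

lemma nrm_eq_weighted_norm: "nrm = weighted_norm {1..<K} (mid_step y)"
proof
  fix u
  have "Re (ip u u) = (weighted_norm {1..<K} (mid_step y) u)\<^sup>2"
    by (simp only: inner_y_def weighted_norm_power2[OF mid_nonneg] Re_sum Re_mult_cnj_self)
  then show "nrm u = weighted_norm {1..<K} (mid_step y) u" by (simp add: norm_y_def)
qed

lemma nrm_nonneg [simp]: "0 \<le> nrm u"
  by (simp add: nrm_eq_weighted_norm)

lemma nrm_power2: "(nrm u)\<^sup>2 = (\<Sum>k = 1..<K. mid_step y k * (cmod (u k))\<^sup>2)"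
  unfolding nrm_eq_weighted_norm by (rule weighted_norm_power2[OF mid_nonneg])

lemma nrm_zero [simp]: "nrm (\<lambda>k. 0) = 0"
  using nrm_power2[of "\<lambda>k. 0"] by simp

lemma nrm_cong: "(\<And>k. k \<in> {1..<K} \<Longrightarrow> cmod (u k) = cmod (v k)) \<Longrightarrow> nrm u = nrm v"
  unfolding nrm_eq_weighted_norm by (rule weighted_norm_cong)

lemma nrm_triangle: "nrm (\<lambda>k. u k + v k) \<le> nrm u + nrm v"
  unfolding nrm_eq_weighted_norm by (rule weighted_norm_triangle[OF mid_nonneg])

lemma nrm_scale: "nrm (\<lambda>k. c * u k) = cmod c * nrm u"
  unfolding nrm_eq_weighted_norm by (rule weighted_norm_scale)

lemma nrm_triangle_diff: "nrm (\<lambda>k. u k - v k) \<le> nrm u + nrm v"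
  using nrm_triangle[of u "\<lambda>k. - 1 * v k"] nrm_scale[of "-1" v] by simp

lemma ip_Cauchy_Schwarz: "cmod (ip u v) \<le> nrm u * nrm v"
  unfolding nrm_eq_weighted_norm inner_y_def by (rule weighted_norm_Cauchy_Schwarz[OF mid_nonneg])

lemma ip_cong:
  "(\<And>k. k \<in> {1..<K} \<Longrightarrow> u k = u' k) \<Longrightarrow> (\<And>k. k \<in> {1..<K} \<Longrightarrow> v k = v' k) \<Longrightarrow> ip u v = ip u' v'"
  by (simp add: inner_y_def)

lemma ip_add: "ip (\<lambda>k. u k + u' k) v = ip u v + ip u' v"
  by (simp add: inner_y_def sum.distrib algebra_simps)

lemma ip_diff: "ip (\<lambda>k. u k - u' k) v = ip u v - ip u' v"
  by (simp add: inner_y_def sum_subtractf algebra_simps)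

lemma ip_scale: "ip (\<lambda>k. c * u k) v = c * ip u v"
  by (simp add: inner_y_def sum_distrib_left mult_ac)

lemma ip_divide: "ip (\<lambda>k. u k / c) v = ip u v / c"
  using ip_scale[of "1 / c" u v] by simp

lemma ip_commute: "ip v u = cnj (ip u v)"
  by (simp add: inner_y_def mult_ac)

lemma ip_self: "ip u u = of_real ((nrm u)\<^sup>2)"
  unfolding nrm_power2 inner_y_def of_real_sum
  by (intro sum.cong refl) (simp add: complex_norm_square[symmetric] mult.commute del: of_real_power)

lemma Re_ip_diff_mean:
  "Re (ip (\<lambda>k. u k - v k) (\<lambda>k. (u k + v k) / 2)) = ((nrm u)\<^sup>2 - (nrm v)\<^sup>2) / 2"
proof -
  have "Re ((u k - v k) * cnj ((u k + v k) / 2) * of_real (mid_step y k)) =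
      (mid_step y k * (cmod (u k))\<^sup>2 - mid_step y k * (cmod (v k))\<^sup>2) / 2" for k
  proof -
    have "Re ((u k - v k) * cnj ((u k + v k) / 2) * of_real (mid_step y k))
        = mid_step y k * Re ((u k - v k) * cnj ((u k + v k) / 2))"
      by (simp only: times_complex.simps Re_complex_of_real Im_complex_of_real) simp
    then show ?thesis unfolding Re_diff_mult_cnj_mean by (simp add: right_diff_distrib)
  qed
  then show ?thesis
    by (simp add: inner_y_def nrm_power2 sum_subtractf[symmetric] sum_divide_distrib[symmetric])
qed

text \<open>  The weights are positive and finite in number; this makes norm convergence pointwise convergence.\<close>

lemma cmod_le_nrm:
  obtains c where "\<And>u k. k \<in> {1..<K} \<Longrightarrow> cmod (u k) \<le> c * nrm u" "0 \<le> c"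
proof
  let ?c = "\<Sum>k = 1..<K. 1 / sqrt (mid_step y k)"
  show "0 \<le> ?c" by (intro sum_nonneg) (simp add: mid_nonneg)
  fix u :: "nat \<Rightarrow> complex" and k assume k: "k \<in> {1..<K}"
  have "mid_step y k * (cmod (u k))\<^sup>2 \<le> (nrm u)\<^sup>2"
    unfolding nrm_power2 by (rule member_le_sum) (use k mid_nonneg in auto)
  then have "sqrt (mid_step y k) * cmod (u k) \<le> nrm u"
    using real_sqrt_le_mono[of "mid_step y k * (cmod (u k))\<^sup>2" "(nrm u)\<^sup>2"]
    by (simp add: real_sqrt_mult)
  then have "cmod (u k) \<le> 1 / sqrt (mid_step y k) * nrm u"
    using mid_pos[OF k] by (simp add: field_simps)
  also have "\<dots> \<le> ?c * nrm u"
    by (intro mult_right_mono nrm_nonneg member_le_sum k) (auto simp: mid_nonneg)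
  finally show "cmod (u k) \<le> ?c * nrm u" .
qed

lemma nrm_eq_0_D: "nrm u = 0 \<Longrightarrow> k \<in> {1..<K} \<Longrightarrow> u k = 0"
  using cmod_le_nrm[of thesis] by (metis cmod_le_nrm mult_zero_right norm_le_zero_iff)

text \<open>  Summation by parts with zero edge values turns the pairing into minus a weighted sum of squares of
  the differences of \<open>v\<close>.\<close>

lemma ip_second_difference_real:
  assumes "v 0 = 0" "v K = 0"
  shows "Im (ip (dhat y (\<lambda>l. of_real (b l) * dbar y v l)) v) = 0"
proof -
  let ?g = "\<lambda>l. of_real (b l) * dbar y v l"
  have "ip (dhat y ?g) v = (\<Sum>k = 1..<K. (?g (k + 1) - ?g k) * cnj (v k))"
    unfolding inner_y_def by (intro sum.cong refl) (use mid_pos in \<open>force simp: dhat_def\<close>)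
  also have "\<dots> = - (\<Sum>k = 1..K. ?g k * (cnj (v k) - cnj (v (k - 1))))"
    by (subst summation_by_parts) (use assms K_pos in auto)
  also have "\<dots> = - (\<Sum>k = 1..K. of_real (b k / mesh_step y k * (cmod (v k - v (k - 1)))\<^sup>2))"
    by (intro arg_cong[where f = uminus] sum.cong refl)
       (simp add: dbar_def complex_norm_square[symmetric] flip: complex_cnj_diff
         del: of_real_power complex_cnj_diff)
  finally show ?thesis by (simp del: of_real_mult of_real_divide of_real_power)
qed

text \<open>  The part of the exterior Hamiltonian that acts within one column.\<close>

definition transverse :: "real \<Rightarrow> real \<Rightarrow> (nat \<Rightarrow> complex) \<Rightarrow> nat \<Rightarrow> complex" where
  "transverse b V v k = of_real b * dhat y (dbar y v) k + of_real V * v k"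

lemma transverse_diff:
  "transverse b V (\<lambda>k. u k - v k) k = transverse b V u k - transverse b V v k"
  by (simp add: transverse_def dhat_def dbar_def diff_divide_distrib add_divide_distrib algebra_simps)

lemma transverse_add:
  "transverse b V (\<lambda>k. u k + v k) k = transverse b V u k + transverse b V v k"
  by (simp add: transverse_def dhat_def dbar_def diff_divide_distrib add_divide_distrib algebra_simps)

lemma transverse_zero: "transverse b V (\<lambda>k. 0) k = 0"
  by (simp add: transverse_def dhat_def dbar_def)

lemma transverse_cong:
  "(\<And>k. k \<le> K \<Longrightarrow> u k = v k) \<Longrightarrow> k \<in> {1..<K} \<Longrightarrow> transverse b V u k = transverse b V v k"
  by (auto simp: transverse_def dhat_def dbar_def)

lemma transverse_real:
  assumes "v 0 = 0" "v K = 0"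
  shows "Im (ip (transverse b V v) v) = 0"
proof -
  have "ip (transverse b V v) v = of_real b * ip (dhat y (dbar y v)) v + of_real V * ip v v"
    unfolding transverse_def[abs_def] by (simp only: ip_add ip_scale)
  moreover have "Im (ip (dhat y (dbar y v)) v) = 0"
    using ip_second_difference_real[OF assms, of "\<lambda>_. 1"] by simp
  ultimately show ?thesis by (simp add: ip_self)
qed

lemma transverse_bounded:
  obtains C where "0 \<le> C" "\<And>v. v 0 = 0 \<Longrightarrow> v K = 0 \<Longrightarrow> nrm (transverse b V v) \<le> C * nrm v"
proof -
  obtain e where e: "\<And>u k. k \<in> {1..<K} \<Longrightarrow> cmod (u k) \<le> e * nrm u" and "0 \<le> e"
    using cmod_le_nrm by blast
  define c where "c k = \<bar>b\<bar> * ((2 * e / mesh_step y (k + 1) + 2 * e / mesh_step y k) / mid_step y k)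
      + \<bar>V\<bar> * e" for k
  define C where "C = weighted_norm {1..<K} (mid_step y) (\<lambda>k. of_real (c k))"
  have "nrm (transverse b V v) \<le> C * nrm v" if v: "v 0 = 0" "v K = 0" for v
  proof -
    have le: "cmod (v k) \<le> e * nrm v" if "k \<le> K" for k
      using e[of k v] v that \<open>0 \<le> e\<close> by (cases "k \<in> {1..<K}") (auto simp: not_le Suc_le_eq)
    have d: "cmod (dbar y v k) \<le> 2 * e * nrm v / mesh_step y k" if "1 \<le> k" "k \<le> K" for k
    proof -
      have "cmod (v k - v (k - 1)) \<le> 2 * e * nrm v"
        using norm_triangle_ineq4[of "v k" "v (k - 1)"] le[of k] le[of "k - 1"] that by force
      then show ?thesis
        using step_pos[OF that] by (simp add: dbar_def norm_divide divide_right_mono)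
    qed
    have "cmod (transverse b V v k) \<le> cmod (of_real (c k * nrm v))" if k: "k \<in> {1..<K}" for k
    proof -
      have "cmod (dhat y (dbar y v) k)
          \<le> (2 * e * nrm v / mesh_step y (k + 1) + 2 * e * nrm v / mesh_step y k) / mid_step y k"
        using norm_triangle_ineq4[of "dbar y v (k + 1)" "dbar y v k"] d[of k] d[of "k + 1"] k mid_pos[OF k]
        by (simp add: dhat_def norm_divide divide_right_mono)
      then have "cmod (transverse b V v k) \<le> \<bar>b\<bar> * ((2 * e * nrm v / mesh_step y (k + 1)
          + 2 * e * nrm v / mesh_step y k) / mid_step y k) + \<bar>V\<bar> * (e * nrm v)"
        unfolding transverse_def using le[of k] k
        by (intro norm_triangle_le add_mono) (auto simp: norm_mult simp del: times_divide_eq_right intro!: mult_left_mono)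
      also have "\<dots> = c k * nrm v" by (simp add: c_def field_simps)
      finally show ?thesis by (simp del: of_real_mult)
    qed
    then have "nrm (transverse b V v) \<le> weighted_norm {1..<K} (mid_step y) (\<lambda>k. of_real (c k * nrm v))"
      unfolding nrm_eq_weighted_norm weighted_norm_def
      by (intro L2_set_mono mult_left_mono) (auto simp: mid_nonneg)
    also have "\<dots> = C * nrm v"
      unfolding C_def using weighted_norm_scale[of "{1..<K}" "mid_step y" "of_real (nrm v)" "\<lambda>k. of_real (c k)"]
      by (simp add: mult.commute)
    finally show ?thesis .
  qed
  then show ?thesis using that[of C] by (simp add: C_def)
qed

end

context cross_section
begin

section \<open>Square-summable functions on a half-line\<close>

text \<open>  Demanding zeros for all \<open>k\<close> outside the open cross-section, not only at its two edges, makes the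
  energy definite: values beyond \<open>K\<close> are invisible to the norm.\<close>

definition finite_energy :: "(nat \<Rightarrow> nat \<Rightarrow> complex) \<Rightarrow> bool" where
  "finite_energy w \<longleftrightarrow> (\<forall>j. \<forall>k. k \<notin> {1..<K} \<longrightarrow> w j k = 0) \<and> summable (\<lambda>j. (nrm (w j))\<^sup>2)"

definition energy :: "(nat \<Rightarrow> nat \<Rightarrow> complex) \<Rightarrow> real" where
  "energy w = (\<Sum>j. (nrm (w j))\<^sup>2)"

lemma finite_energyD:
  assumes "finite_energy w"
  shows "k \<notin> {1..<K} \<Longrightarrow> w j k = 0" "w j 0 = 0" "w j K = 0" "summable (\<lambda>j. (nrm (w j))\<^sup>2)"
  using assms by (auto simp: finite_energy_def)

lemma nrm_add_power2_le: "(nrm (\<lambda>k. u k + v k))\<^sup>2 \<le> 2 * (nrm u)\<^sup>2 + 2 * (nrm v)\<^sup>2"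
proof -
  have "(nrm (\<lambda>k. u k + v k))\<^sup>2 \<le> (nrm u + nrm v)\<^sup>2"
    by (rule power_mono[OF nrm_triangle nrm_nonneg])
  also have "\<dots> \<le> 2 * (nrm u)\<^sup>2 + 2 * (nrm v)\<^sup>2"
    using sum_squares_bound[of "nrm u" "nrm v"] by (simp add: power2_sum)
  finally show ?thesis .
qed

lemma summable_nrm_add:
  assumes "summable (\<lambda>j. (nrm (u j))\<^sup>2)" "summable (\<lambda>j. (nrm (v j))\<^sup>2)"
  shows "summable (\<lambda>j. (nrm (\<lambda>k. u j k + v j k))\<^sup>2)"
  by (rule summable_comparison_test'[where g = "\<lambda>j. 2 * (nrm (u j))\<^sup>2 + 2 * (nrm (v j))\<^sup>2"])
     (use assms nrm_add_power2_le in \<open>auto intro!: summable_add summable_mult\<close>)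

lemma summable_nrm_scale:
  "summable (\<lambda>j. (nrm (u j))\<^sup>2) \<Longrightarrow> summable (\<lambda>j. (nrm (\<lambda>k. c * u j k))\<^sup>2)"
  by (simp add: nrm_scale power_mult_distrib summable_mult)

lemma summable_nrm_diff:
  assumes "summable (\<lambda>j. (nrm (u j))\<^sup>2)" "summable (\<lambda>j. (nrm (v j))\<^sup>2)"
  shows "summable (\<lambda>j. (nrm (\<lambda>k. u j k - v j k))\<^sup>2)"
  using summable_nrm_add[OF assms(1) summable_nrm_scale[OF assms(2), of "-1"]] by simp

lemma nrm_le_sqrt_energy:
  assumes "finite_energy w"
  shows "nrm (w j) \<le> sqrt (energy w)"
proof -
  have "(nrm (w j))\<^sup>2 \<le> energy w"
    unfolding energy_def using finite_energyD(4)[OF assms] sum_le_suminf[of "\<lambda>j. (nrm (w j))\<^sup>2" "{j}"] by simp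
  then show ?thesis by (rule real_le_rsqrt)
qed

text \<open>  A contraction of the energy has a fixed point: the Neumann series converges entry by entry, because
  entries are bounded by the energy, and its sum has finite energy by Fatou's argument, the partial
  sums over finitely many columns being bounded independently of the number of terms.\<close>

lemma neumann_series:
  fixes T :: "(nat \<Rightarrow> nat \<Rightarrow> complex) \<Rightarrow> nat \<Rightarrow> nat \<Rightarrow> complex"
  assumes q: "0 \<le> q" "q < 1"
    and T_diff: "\<And>u v. T (\<lambda>j k. u j k - v j k) = (\<lambda>j k. T u j k - T v j k)"
    and T_lim: "\<And>f l j k. (\<And>j k. (\<lambda>n. f n j k) \<longlonglongrightarrow> l j k) \<Longrightarrow> (\<lambda>n. T (f n) j k) \<longlonglongrightarrow> T l j k"
    and T_zero: "\<And>w. T w 0 = (\<lambda>k. 0)"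
    and T_contr: "\<And>w. finite_energy w \<Longrightarrow> w 0 = (\<lambda>k. 0) \<Longrightarrow>
            finite_energy (T w) \<and> energy (T w) \<le> q\<^sup>2 * energy w"
    and b: "finite_energy b" "b 0 = (\<lambda>k. 0)"
  obtains w where "finite_energy w" "\<And>j k. w j k = b j k + T w j k"
proof -
  define P where "P = rec_nat (\<lambda>j k. 0) (\<lambda>n w j k. b j k + T w j k)"
  have P0: "P 0 = (\<lambda>j k. 0)" and PS: "P (Suc n) = (\<lambda>j k. b j k + T (P n) j k)" for n
    by (simp_all add: P_def)
  define D where "D n = (\<lambda>j k. P (Suc n) j k - P n j k)" for n
  have T0: "T (\<lambda>j k. 0) = (\<lambda>j k. 0)"
    using T_diff[of "\<lambda>j k. 0" "\<lambda>j k. 0"] by simp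
  have D0: "D 0 = b" by (simp add: D_def PS P0 T0)
  have DS: "D (Suc n) = T (D n)" for n
    unfolding D_def T_diff by (intro ext) (simp add: PS[of "Suc n"] PS[of n])
  have D: "finite_energy (D n) \<and> D n 0 = (\<lambda>k. 0) \<and> energy (D n) \<le> (q ^ n)\<^sup>2 * energy b" for n
  proof (induction n)
    case 0
    then show ?case using b by (simp add: D0)
  next
    case (Suc n)
    then have "finite_energy (T (D n))" "energy (T (D n)) \<le> q\<^sup>2 * energy (D n)"
      using T_contr by auto
    moreover have "q\<^sup>2 * energy (D n) \<le> q\<^sup>2 * ((q ^ n)\<^sup>2 * energy b)"
      using Suc by (intro mult_left_mono) auto
    ultimately show ?case using T_zero by (simp add: DS power_mult_distrib mult_ac)
  qed
  \<comment> \<open>\<open>R / (1 - q)\<close> will bound the square root of the energy of all partial sums.\<close>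
  define R where "R = sqrt (energy b)"
  have R: "0 \<le> R" using nrm_le_sqrt_energy[OF b(1), of 0] nrm_nonneg[of "b 0"] R_def by linarith
  have sqrtD: "sqrt (energy (D n)) \<le> q ^ n * R" for n
  proof -
    have "sqrt (energy (D n)) \<le> sqrt ((q ^ n)\<^sup>2 * energy b)" using D by (intro real_sqrt_le_mono) auto
    then show ?thesis using q by (simp add: real_sqrt_mult R_def)
  qed
  have nrmD: "nrm (D n j) \<le> q ^ n * R" for n j
    using nrm_le_sqrt_energy[of "D n" j] D sqrtD order_trans by blast
  have P_sum: "P n j k = (\<Sum>i<n. D i j k)" for n j k
    by (induction n) (simp_all add: P0 D_def)
  have "summable (\<lambda>i. D i j k)" for j k
  proof (cases "k \<in> {1..<K}")
    case True
    obtain c where c: "\<And>u k. k \<in> {1..<K} \<Longrightarrow> cmod (u k) \<le> c * nrm u" "0 \<le> c"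
      using cmod_le_nrm by blast
    have "cmod (D i j k) \<le> c * (q ^ i * R)" for i
      using c(1)[OF True, of "D i j"] mult_left_mono[OF nrmD c(2)] order_trans by blast
    then show ?thesis
      using q by (intro summable_comparison_test'[OF summable_mult[OF summable_mult2[OF
            summable_geometric[of q]]], of 0]) auto
  next
    case False
    then have "D i j k = 0" for i using D finite_energyD(1) by blast
    then show ?thesis by simp
  qed
  then have lim: "(\<lambda>n. P n j k) \<longlonglongrightarrow> (\<Sum>i. D i j k)" for j k
    unfolding P_sum by (rule summable_LIMSEQ)
  define w where "w = (\<lambda>j k. \<Sum>i. D i j k)"
  have lim: "(\<lambda>n. P n j k) \<longlonglongrightarrow> w j k" for j k using lim by (simp add: w_def)
  have fixed: "w j k = b j k + T w j k" for j k
  proof (rule LIMSEQ_unique)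
    show "(\<lambda>n. P (Suc n) j k) \<longlonglongrightarrow> w j k" by (rule LIMSEQ_Suc[OF lim])
    show "(\<lambda>n. P (Suc n) j k) \<longlonglongrightarrow> b j k + T w j k"
      unfolding PS by (intro tendsto_intros T_lim lim)
  qed
  have partial: "L2_set (\<lambda>j. nrm (P n j)) {..<L} \<le> R / (1 - q)" for n L
  proof -
    have "L2_set (\<lambda>j. nrm (P n j)) {..<L} \<le> (\<Sum>i<n. q ^ i * R)"
    proof (induction n)
      case 0
      then show ?case by (simp add: P0 L2_set_def)
    next
      case (Suc n)
      have "L2_set (\<lambda>j. nrm (P (Suc n) j)) {..<L} \<le> L2_set (\<lambda>j. nrm (P n j) + nrm (D n j)) {..<L}"
      proof (rule L2_set_mono)
        fix j
        show "nrm (P (Suc n) j) \<le> nrm (P n j) + nrm (D n j)"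
          using nrm_triangle[of "P n j" "D n j"] by (simp add: D_def)
      qed simp
      also have "\<dots> \<le> L2_set (\<lambda>j. nrm (P n j)) {..<L} + L2_set (\<lambda>j. nrm (D n j)) {..<L}"
        by (rule L2_set_triangle_ineq)
      also have "L2_set (\<lambda>j. nrm (D n j)) {..<L} \<le> sqrt (energy (D n))"
        unfolding L2_set_def energy_def using D finite_energyD(4)
        by (intro real_sqrt_le_mono sum_le_suminf) auto
      finally show ?case using Suc sqrtD[of n] by simp
    qed
    also have "\<dots> = R * (\<Sum>i<n. q ^ i)" by (simp add: sum_distrib_left mult.commute)
    also have "\<dots> \<le> R * (\<Sum>i. q ^ i)"
      using q R by (intro mult_left_mono sum_le_suminf summable_geometric) auto
    also have "\<dots> = R / (1 - q)" using q by (simp add: suminf_geometric)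
    finally show ?thesis .
  qed
  have "(\<Sum>j<L. (nrm (w j))\<^sup>2) \<le> (R / (1 - q))\<^sup>2" for L
  proof (rule LIMSEQ_le_const2)
    show "(\<lambda>n. \<Sum>j<L. (nrm (P n j))\<^sup>2) \<longlonglongrightarrow> (\<Sum>j<L. (nrm (w j))\<^sup>2)"
      unfolding nrm_power2 by (intro tendsto_intros lim)
    have "(\<Sum>j<L. (nrm (P n j))\<^sup>2) \<le> (R / (1 - q))\<^sup>2" for n
      using power_mono[OF partial[of n L] L2_set_nonneg, of 2] by (simp add: L2_set_def sum_nonneg)
    then show "\<exists>N. \<forall>n\<ge>N. (\<Sum>j<L. (nrm (P n j))\<^sup>2) \<le> (R / (1 - q))\<^sup>2" by blast
  qed
  then have "summable (\<lambda>j. (nrm (w j))\<^sup>2)"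
    by (intro bounded_imp_summable[where B = "(R / (1 - q))\<^sup>2"])
       (auto simp flip: lessThan_Suc_atMost simp del: sum.lessThan_Suc)
  moreover have "w j k = 0" if "k \<notin> {1..<K}" for j k
  proof -
    have "D i j k = 0" for i using D finite_energyD(1)[OF _ that] by blast
    then show ?thesis by (simp add: w_def)
  qed
  ultimately have "finite_energy w" by (simp add: finite_energy_def)
  then show ?thesis using fixed that by blast
qed

section \<open>The Hamiltonian on a half-line\<close>

text \<open>  On a half-line, column \<open>0\<close> carries the boundary value; the operator is meant at columns \<open>j \<ge> 1\<close>.\<close>

definition half_line_H ::
  "real \<Rightarrow> real \<Rightarrow> real \<Rightarrow> (nat \<Rightarrow> nat \<Rightarrow> complex) \<Rightarrow> nat \<Rightarrow> nat \<Rightarrow> complex" where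
  "half_line_H \<kappa> b V w j k =
     - of_real \<kappa> * (w (j + 1) k - 2 * w j k + w (j - 1) k) + transverse b V (w j) k"

text \<open>  Up to a positive factor, the mass current from column \<open>j\<close> to column \<open>j + 1\<close>.\<close>

definition flux :: "(nat \<Rightarrow> nat \<Rightarrow> complex) \<Rightarrow> nat \<Rightarrow> real" where
  "flux w j = Im (ip (w (j + 1)) (w j))"

text \<open>  The transverse part is symmetric and \<open>(w j, w j)\<close> is real, so that only the pairings with the two
  neighbouring columns contribute, and exchanging the arguments of \<open>inner_y\<close> conjugates.\<close>

lemma Im_ip_half_line_H:
  assumes "w j 0 = 0" "w j K = 0" "1 \<le> j"
  shows "Im (ip (half_line_H \<kappa> b V w j) (w j)) = \<kappa> * (flux w (j - 1) - flux w j)"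
proof -
  have "ip (half_line_H \<kappa> b V w j) (w j) = - of_real \<kappa> * (ip (w (j + 1)) (w j)
      - 2 * ip (w j) (w j) + ip (w (j - 1)) (w j)) + ip (transverse b V (w j)) (w j)"
    unfolding half_line_H_def[abs_def] by (simp only: ip_add ip_diff ip_scale)
  moreover have "Im (ip (w (j - 1)) (w j)) = - flux w (j - 1)"
    using assms(3) ip_commute[of "w (j - 1)" "w j"] by (simp add: flux_def)
  ultimately show ?thesis
    using transverse_real[OF assms(1,2), of b V]
    by (simp only: ip_self flux_def) (simp add: algebra_simps del: of_real_power)
qed

lemma nrm_tendsto_0:
  assumes "summable (\<lambda>j. (nrm (w j))\<^sup>2)"
  shows "(\<lambda>j. nrm (w j)) \<longlonglongrightarrow> 0"
  using tendsto_real_sqrt[OF summable_LIMSEQ_zero[OF assms]] by simp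

lemma flux_tendsto_0:
  assumes "summable (\<lambda>j. (nrm (w j))\<^sup>2)"
  shows "flux w \<longlonglongrightarrow> 0"
proof (rule Lim_null_comparison)
  have "\<bar>flux w j\<bar> \<le> nrm (w (j + 1)) * nrm (w j)" for j
    unfolding flux_def using abs_Im_le_cmod ip_Cauchy_Schwarz order_trans by blast
  then show "\<forall>\<^sub>F j in sequentially. norm (flux w j) \<le> nrm (w (j + 1)) * nrm (w j)" by simp
  show "(\<lambda>j. nrm (w (j + 1)) * nrm (w j)) \<longlonglongrightarrow> 0"
    using tendsto_mult[OF LIMSEQ_Suc[OF nrm_tendsto_0[OF assms]] nrm_tendsto_0[OF assms]] by simp
qed

text \<open>  The fluxes telescope and vanish at infinity. In particular the half-line operator is symmetric on
  functions that vanish in column \<open>0\<close>.\<close>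

lemma Im_ip_half_line_H_sums:
  assumes "\<And>j. w j 0 = 0" "\<And>j. w j K = 0" "summable (\<lambda>j. (nrm (w j))\<^sup>2)"
  shows "(\<lambda>j. Im (ip (half_line_H \<kappa> b V w (j + 1)) (w (j + 1)))) sums (\<kappa> * flux w 0)"
  using sums_mult[OF telescope_sums'[OF flux_tendsto_0[OF assms(3)]], of \<kappa>] assms(1,2)
  by (simp add: Im_ip_half_line_H)

text \<open>  Each value involves three columns, each with an operator of norm at most \<open>2 \<kappa> + C\<close>, where \<open>C\<close>
  bounds the transverse part.\<close>

lemma half_line_H_bounded:
  assumes "0 \<le> \<kappa>"
  shows "\<exists>C\<ge>0. \<forall>w. finite_energy w \<longrightarrow>
    summable (\<lambda>j. (nrm (half_line_H \<kappa> b V w (j + 1)))\<^sup>2) \<and>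
    (\<Sum>j. (nrm (half_line_H \<kappa> b V w (j + 1)))\<^sup>2) \<le> C * energy w"
proof -
  obtain C where C: "0 \<le> C" "\<And>v. v 0 = 0 \<Longrightarrow> v K = 0 \<Longrightarrow> nrm (transverse b V v) \<le> C * nrm v"
    using transverse_bounded by blast
  define c where "c = 2 * \<kappa> + C"
  have "summable (\<lambda>j. (nrm (half_line_H \<kappa> b V w (j + 1)))\<^sup>2) \<and>
    (\<Sum>j. (nrm (half_line_H \<kappa> b V w (j + 1)))\<^sup>2) \<le> 9 * c\<^sup>2 * energy w" if w: "finite_energy w" for w
  proof -
    define n where "n j = (nrm (w j))\<^sup>2" for j
    have n: "summable n" "\<And>j. 0 \<le> n j" using finite_energyD(4)[OF w] by (auto simp: n_def[abs_def])
    have le: "(nrm (half_line_H \<kappa> b V w (j + 1)))\<^sup>2 \<le> 3 * c\<^sup>2 * (n (j + 2) + n (j + 1) + n j)" for j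
    proof -
      have "nrm (half_line_H \<kappa> b V w (j + 1))
          \<le> nrm (\<lambda>k. - of_real \<kappa> * (w (j + 2) k - 2 * w (j + 1) k + w j k)) + nrm (transverse b V (w (j + 1)))"
        using nrm_triangle[of "\<lambda>k. - of_real \<kappa> * (w (j + 2) k - 2 * w (j + 1) k + w j k)"
            "transverse b V (w (j + 1))"]
        by (simp add: half_line_H_def[abs_def])
      also have "nrm (\<lambda>k. - of_real \<kappa> * (w (j + 2) k - 2 * w (j + 1) k + w j k))
          = \<kappa> * nrm (\<lambda>k. w (j + 2) k - 2 * w (j + 1) k + w j k)"
        using assms by (simp only: nrm_scale) simp
      also have "nrm (\<lambda>k. w (j + 2) k - 2 * w (j + 1) k + w j k)
          \<le> nrm (\<lambda>k. w (j + 2) k - 2 * w (j + 1) k) + nrm (w j)"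
        by (rule nrm_triangle)
      also have "nrm (\<lambda>k. w (j + 2) k - 2 * w (j + 1) k) \<le> nrm (w (j + 2)) + nrm (\<lambda>k. 2 * w (j + 1) k)"
        by (rule nrm_triangle_diff)
      also have "nrm (\<lambda>k. 2 * w (j + 1) k) = 2 * nrm (w (j + 1))" by (simp only: nrm_scale) simp
      also have "nrm (transverse b V (w (j + 1))) \<le> C * nrm (w (j + 1))"
        using finite_energyD(2,3)[OF w] by (rule C(2))
      also have "\<kappa> * (nrm (w (j + 2)) + 2 * nrm (w (j + 1)) + nrm (w j)) + C * nrm (w (j + 1))
          \<le> c * (nrm (w (j + 2)) + nrm (w (j + 1)) + nrm (w j))"
        using C(1) assms mult_nonneg_nonneg[OF C(1) nrm_nonneg] mult_nonneg_nonneg[OF assms nrm_nonneg]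
        by (simp add: c_def algebra_simps add_increasing)
      finally have "nrm (half_line_H \<kappa> b V w (j + 1))
          \<le> c * (nrm (w (j + 2)) + nrm (w (j + 1)) + nrm (w j))"
        using assms by (simp add: mult_left_mono)
      then have "(nrm (half_line_H \<kappa> b V w (j + 1)))\<^sup>2
          \<le> (c * (nrm (w (j + 2)) + nrm (w (j + 1)) + nrm (w j)))\<^sup>2"
        by (rule power_mono) simp
      also have "\<dots> = c\<^sup>2 * (nrm (w (j + 2)) + nrm (w (j + 1)) + nrm (w j))\<^sup>2"
        by (rule power_mult_distrib)
      also have "\<dots> \<le> c\<^sup>2 * (3 * (n (j + 2) + n (j + 1) + n j))"
      proof (rule mult_left_mono)
        have "(p + q + r)\<^sup>2 \<le> 3 * (p\<^sup>2 + q\<^sup>2 + r\<^sup>2)" for p q r :: real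
          using sum_squares_bound[of p q] sum_squares_bound[of p r] sum_squares_bound[of q r]
          by (simp add: power2_eq_square algebra_simps)
        then show "(nrm (w (j + 2)) + nrm (w (j + 1)) + nrm (w j))\<^sup>2 \<le> 3 * (n (j + 2) + n (j + 1) + n j)"
          by (simp add: n_def)
      qed simp
      finally show ?thesis by (simp only: mult.assoc mult.left_commute[of "c\<^sup>2" 3])
    qed
    have n1: "summable (\<lambda>j. n (j + 1))" and n2: "summable (\<lambda>j. n (j + 2))"
      using n(1) summable_iff_shift[of n 1] summable_iff_shift[of n 2] by blast+
    have "(\<Sum>j. n (j + 1)) \<le> suminf n" "(\<Sum>j. n (j + 2)) \<le> suminf n"
      using suminf_split_initial_segment[OF n(1), of 1] suminf_split_initial_segment[OF n(1), of 2]
        sum_nonneg[of "{..<1}" n] sum_nonneg[of "{..<2}" n] n(2) by auto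
    then have "(\<Sum>j. n (j + 2) + n (j + 1) + n j) \<le> 3 * suminf n"
      using suminf_add[OF summable_add[OF n2 n1] n(1)] suminf_add[OF n2 n1] by simp
    moreover have S: "summable (\<lambda>j. n (j + 2) + n (j + 1) + n j)"
      by (intro summable_add n1 n2 n(1))
    moreover have sum: "summable (\<lambda>j. (nrm (half_line_H \<kappa> b V w (j + 1)))\<^sup>2)"
      by (rule summable_comparison_test'[OF summable_mult[OF S, of "3 * c\<^sup>2"], of 0]) (use le in simp)
    moreover have "(\<Sum>j. (nrm (half_line_H \<kappa> b V w (j + 1)))\<^sup>2)
        \<le> 3 * c\<^sup>2 * (\<Sum>j. n (j + 2) + n (j + 1) + n j)"
      unfolding suminf_mult[OF S, symmetric] by (intro suminf_le le sum summable_mult S)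
    moreover have "3 * c\<^sup>2 * (\<Sum>j. n (j + 2) + n (j + 1) + n j) \<le> 3 * c\<^sup>2 * (3 * suminf n)"
      using calculation(1) by (intro mult_left_mono) auto
    moreover have "3 * c\<^sup>2 * (3 * suminf n) = 9 * c\<^sup>2 * energy w"
      by (simp add: energy_def n_def[abs_def])
    ultimately show ?thesis by linarith
  qed
  then show ?thesis by (intro exI[of _ "9 * c\<^sup>2"]) simp
qed

text \<open>  The cross term is what makes the iteration below a contraction: it is a flux, and it sums to zero
  for a symmetric operator.\<close>

lemma nrm_power2_real_minus_imaginary:
  "(nrm (\<lambda>k. of_real p * u k - \<i> * of_real q * v k))\<^sup>2
     = p\<^sup>2 * (nrm u)\<^sup>2 + q\<^sup>2 * (nrm v)\<^sup>2 + 2 * p * q * Im (ip v u)"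
proof -
  have "mid_step y k * (cmod (of_real p * u k - \<i> * of_real q * v k))\<^sup>2
      = p\<^sup>2 * (mid_step y k * (cmod (u k))\<^sup>2) + q\<^sup>2 * (mid_step y k * (cmod (v k))\<^sup>2)
        + 2 * p * q * Im (v k * cnj (u k) * of_real (mid_step y k))" for k
    unfolding cmod_power2 by (simp add: power2_eq_square algebra_simps)
  then show ?thesis
    by (simp add: nrm_power2 inner_y_def sum.distrib sum_distrib_left)
qed

lemma half_line_H_diff:
  "half_line_H \<kappa> b V (\<lambda>j k. u j k - v j k) j k = half_line_H \<kappa> b V u j k - half_line_H \<kappa> b V v j k"
  by (simp add: half_line_H_def transverse_diff algebra_simps)

lemma half_line_H_add:
  "half_line_H \<kappa> b V (\<lambda>j k. u j k + v j k) j k = half_line_H \<kappa> b V u j k + half_line_H \<kappa> b V v j k"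
  by (simp add: half_line_H_def transverse_add algebra_simps)

text \<open>  The equation \<open>(\<i> \<alpha> - H) w = G\<close> is the fixed-point equation
  \<open>w = ((1 - \<epsilon> \<alpha>) - \<i> \<epsilon> H) w - \<i> \<epsilon> G\<close>. By symmetry of \<open>H\<close>, the operator on the right scales the
  energy by at most \<open>(1 - \<epsilon> \<alpha>)\<^sup>2 + \<epsilon>\<^sup>2 C\<close>, if \<open>C\<close> is the bound of \<open>half_line_H_bounded\<close>. An
  extension of the boundary value by zero is subtracted first, because symmetry requires zero
  boundary values.\<close>

lemma half_line_resolvent:
  assumes "0 \<le> \<kappa>" "0 < \<alpha>" and g: "\<And>k. k \<notin> {1..<K} \<Longrightarrow> g k = 0"
    and G: "summable (\<lambda>j. (nrm (G (j + 1)))\<^sup>2)"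
  shows "\<exists>w. finite_energy w \<and> w 0 = g \<and>
    (\<forall>j\<ge>1. \<forall>k\<in>{1..<K}. \<i> * of_real \<alpha> * w j k - half_line_H \<kappa> b V w j k = G j k)"
proof -
  let ?H = "half_line_H \<kappa> b V"
  obtain C where C: "0 \<le> C" "\<And>w. finite_energy w \<Longrightarrow> summable (\<lambda>j. (nrm (?H w (j + 1)))\<^sup>2) \<and>
      (\<Sum>j. (nrm (?H w (j + 1)))\<^sup>2) \<le> C * energy w"
    using half_line_H_bounded[OF assms(1), of b V] by blast
  \<comment> \<open>This \<open>\<epsilon>\<close> minimises \<open>(1 - \<epsilon> \<alpha>)\<^sup>2 + \<epsilon>\<^sup>2 C\<close>, and \<open>q\<^sup>2\<close> is the minimum.\<close>
  define \<epsilon> where "\<epsilon> = \<alpha> / (\<alpha>\<^sup>2 + C)"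
  define q where "q = sqrt (C / (\<alpha>\<^sup>2 + C))"
  have pos: "0 < \<alpha>\<^sup>2 + C" using assms C by (simp add: add_pos_nonneg)
  have \<epsilon>: "0 < \<epsilon>" using pos assms by (simp add: \<epsilon>_def)
  have "C / (\<alpha>\<^sup>2 + C) < 1" using pos assms by simp
  then have q: "0 \<le> q" "q < 1" using C(1) pos by (simp_all add: q_def)
  have q2: "(1 - \<epsilon> * \<alpha>)\<^sup>2 + \<epsilon>\<^sup>2 * C = q\<^sup>2"
  proof -
    have "(1 - \<epsilon> * \<alpha>)\<^sup>2 + \<epsilon>\<^sup>2 * C = 1 - 2 * (\<epsilon> * \<alpha>) + \<epsilon>\<^sup>2 * (\<alpha>\<^sup>2 + C)"
      by (simp add: power2_eq_square algebra_simps)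
    also have "\<epsilon>\<^sup>2 * (\<alpha>\<^sup>2 + C) = \<epsilon> * \<alpha>" using pos by (simp add: \<epsilon>_def power2_eq_square)
    also have "1 - 2 * (\<epsilon> * \<alpha>) + \<epsilon> * \<alpha> = 1 - \<alpha>\<^sup>2 / (\<alpha>\<^sup>2 + C)"
      by (simp add: \<epsilon>_def power2_eq_square)
    also have "\<dots> = C / (\<alpha>\<^sup>2 + C)"
      using pos add_divide_distrib[of "\<alpha>\<^sup>2" C "\<alpha>\<^sup>2 + C"] by simp
    finally show ?thesis using C(1) pos by (simp add: q_def)
  qed
  define T where "T w j k = (if j = 0 \<or> k \<notin> {1..<K} then 0 else
      of_real (1 - \<epsilon> * \<alpha>) * w j k - \<i> * of_real \<epsilon> * ?H w j k)" for w j k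
  have T_diff: "T (\<lambda>j k. u j k - v j k) = (\<lambda>j k. T u j k - T v j k)" for u v
    by (intro ext) (simp add: T_def half_line_H_diff right_diff_distrib)
  have T_lim: "(\<lambda>n. T (f n) j k) \<longlonglongrightarrow> T l j k"
    if "\<And>j k. (\<lambda>n. f n j k) \<longlonglongrightarrow> l j k" for f l j k
    unfolding T_def half_line_H_def transverse_def dhat_def dbar_def divide_inverse
    by (cases "j = 0 \<or> k \<notin> {1..<K}") (auto intro!: tendsto_intros that)
  have T_zero: "T w 0 = (\<lambda>k. 0)" for w by (intro ext) (simp add: T_def)
  have T_contr: "finite_energy (T w) \<and> energy (T w) \<le> q\<^sup>2 * energy w"
    if w: "finite_energy w" "w 0 = (\<lambda>k. 0)" for w
  proof -
    have row: "(nrm (T w (j + 1)))\<^sup>2 = (1 - \<epsilon> * \<alpha>)\<^sup>2 * (nrm (w (j + 1)))\<^sup>2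
        + \<epsilon>\<^sup>2 * (nrm (?H w (j + 1)))\<^sup>2 + 2 * (1 - \<epsilon> * \<alpha>) * \<epsilon> * Im (ip (?H w (j + 1)) (w (j + 1)))" for j
      unfolding nrm_power2_real_minus_imaginary[symmetric]
      by (intro arg_cong[where f = "\<lambda>a. a\<^sup>2"] nrm_cong) (simp add: T_def)
    have "(\<lambda>j. (nrm (w (j + 1)))\<^sup>2) sums energy w"
      using finite_energyD(4)[OF w(1)] w(2) sums_Suc_iff[of "\<lambda>j. (nrm (w j))\<^sup>2" "energy w"]
      by (simp add: energy_def summable_sums)
    moreover have "(\<lambda>j. (nrm (?H w (j + 1)))\<^sup>2) sums (\<Sum>j. (nrm (?H w (j + 1)))\<^sup>2)"
      using C(2)[OF w(1)] by (simp add: summable_sums)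
    moreover have "(\<lambda>j. Im (ip (?H w (j + 1)) (w (j + 1)))) sums 0"
      using Im_ip_half_line_H_sums[OF finite_energyD(2,3,4)[OF w(1)], of \<kappa> b V] w(2)
      by (simp add: flux_def inner_y_def)
    ultimately have "(\<lambda>j. (nrm (T w (j + 1)))\<^sup>2) sums ((1 - \<epsilon> * \<alpha>)\<^sup>2 * energy w
        + \<epsilon>\<^sup>2 * (\<Sum>j. (nrm (?H w (j + 1)))\<^sup>2) + 2 * (1 - \<epsilon> * \<alpha>) * \<epsilon> * 0)"
      unfolding row by (intro sums_add sums_mult)
    moreover have "T w 0 = (\<lambda>k. 0)" by (rule T_zero)
    ultimately have sums: "(\<lambda>j. (nrm (T w j))\<^sup>2) sums ((1 - \<epsilon> * \<alpha>)\<^sup>2 * energy w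
        + \<epsilon>\<^sup>2 * (\<Sum>j. (nrm (?H w (j + 1)))\<^sup>2))"
      using sums_Suc_iff[of "\<lambda>j. (nrm (T w j))\<^sup>2"] by simp
    have "energy (T w) = (1 - \<epsilon> * \<alpha>)\<^sup>2 * energy w + \<epsilon>\<^sup>2 * (\<Sum>j. (nrm (?H w (j + 1)))\<^sup>2)"
      using sums unfolding energy_def by (rule sums_unique[symmetric])
    also have "\<dots> \<le> (1 - \<epsilon> * \<alpha>)\<^sup>2 * energy w + \<epsilon>\<^sup>2 * (C * energy w)"
      using C(2)[OF w(1)] by (intro add_left_mono mult_left_mono) auto
    also have "\<dots> = q\<^sup>2 * energy w" unfolding q2[symmetric] by (simp add: algebra_simps)
    finally show ?thesis
      using sums by (auto simp: finite_energy_def T_def dest: sums_summable)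
  qed
  define g0 where "g0 j k = (if j = 0 then g k else 0)" for j :: nat and k
  have "summable (\<lambda>j. (nrm (g0 j))\<^sup>2)"
    by (rule summable_finite[of "{0}"]) (auto simp: g0_def[abs_def])
  then have g0: "finite_energy g0" using g by (simp add: finite_energy_def g0_def)
  define b' where "b' j k = (if j = 0 \<or> k \<notin> {1..<K} then 0 else
      - \<i> * of_real \<epsilon> * (G j k + ?H g0 j k))" for j k
  have "summable (\<lambda>j. (nrm (\<lambda>k. - \<i> * of_real \<epsilon> * (G (j + 1) k + ?H g0 (j + 1) k)))\<^sup>2)"
    using C(2)[OF g0] by (intro summable_nrm_scale summable_nrm_add G) auto
  also have "(\<lambda>j. nrm (\<lambda>k. - \<i> * of_real \<epsilon> * (G (j + 1) k + ?H g0 (j + 1) k))) = (\<lambda>j. nrm (b' (j + 1)))"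
    by (intro ext nrm_cong) (simp add: b'_def)
  finally have "summable (\<lambda>j. (nrm (b' j))\<^sup>2)"
    using summable_Suc_iff[of "\<lambda>j. (nrm (b' j))\<^sup>2"] by simp
  then have "finite_energy b'" "b' 0 = (\<lambda>k. 0)" by (auto simp: finite_energy_def b'_def)
  then obtain v where v: "finite_energy v" "\<And>j k. v j k = b' j k + T v j k"
    using neumann_series[of q T b', OF q T_diff T_lim T_zero T_contr] by blast
  show ?thesis
  proof (intro exI[of _ "\<lambda>j k. v j k + g0 j k"] conjI allI impI ballI)
    show "finite_energy (\<lambda>j k. v j k + g0 j k)"
      using v(1) g0 summable_nrm_add by (simp add: finite_energy_def)
    show "(\<lambda>k. v 0 k + g0 0 k) = g"
      by (intro ext) (simp add: v(2)[of 0] b'_def T_def g0_def)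
    fix j k assume jk: "1 \<le> (j :: nat)" "k \<in> {1..<K}"
    have "v j k = - \<i> * of_real \<epsilon> * (G j k + ?H g0 j k)
        + (of_real (1 - \<epsilon> * \<alpha>) * v j k - \<i> * of_real \<epsilon> * ?H v j k)"
      using jk by (subst v(2)) (simp add: b'_def T_def)
    then have "of_real \<epsilon> * (of_real \<alpha> * v j k) = of_real \<epsilon> * (- \<i> * (G j k + ?H g0 j k + ?H v j k))"
      unfolding of_real_diff of_real_mult of_real_1 by algebra
    then have "of_real \<alpha> * v j k = - \<i> * (G j k + ?H g0 j k + ?H v j k)"
      by (rule mult_left_cancel[THEN iffD1, rotated]) (use \<epsilon> in simp)
    then have "\<i> * (of_real \<alpha> * v j k) = G j k + ?H g0 j k + ?H v j k" by simp
    moreover have "g0 j k = 0" using jk by (simp add: g0_def)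
    ultimately show "\<i> * of_real \<alpha> * (v j k + g0 j k) - ?H (\<lambda>j k. v j k + g0 j k) j k = G j k"
      by (simp add: half_line_H_add mult.assoc)
  qed
qed

end

section \<open>The exterior problem\<close>

locale exterior_mesh = cross_section +
  fixes hbar \<tau> \<rho>_inf B1_inf B2_inf V_inf :: real and x :: "nat \<Rightarrow> real" and J :: nat
  assumes hbar: "0 < hbar" and \<tau>: "0 < \<tau>" and \<rho>_inf: "0 < \<rho>_inf" and B1_inf: "0 < B1_inf"
    and x_mono: "strict_mono x" and J_pos: "1 \<le> J"
    and uniform: "\<And>j. J \<le> j \<Longrightarrow> mesh_step x j = mesh_step x J"
begin

text \<open>  With these constants the exterior problem takes the form
  \<open>\<i> a (U m - U (m - 1)) = half_line_H \<kappa> \<beta> V_inf W\<close>, where \<open>W\<close> is the time mean of \<open>U\<close>.\<close>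

definition "h = mesh_step x J"
definition "\<kappa> = hbar\<^sup>2 * B1_inf / (2 * h\<^sup>2)"
definition "\<beta> = - (hbar\<^sup>2 / 2 * B2_inf)"
definition "a = hbar * \<rho>_inf / \<tau>"

abbreviation exterior_H :: "(nat \<Rightarrow> nat \<Rightarrow> complex) \<Rightarrow> nat \<Rightarrow> nat \<Rightarrow> complex" where
  "exterior_H \<equiv> half_line_H \<kappa> \<beta> V_inf"

abbreviation time_mean :: "(nat \<Rightarrow> nat \<Rightarrow> nat \<Rightarrow> complex) \<Rightarrow> nat \<Rightarrow> nat \<Rightarrow> nat \<Rightarrow> complex" where
  "time_mean U m j k \<equiv> sbar (\<lambda>n. U n j k) m"

abbreviation exterior :: "(nat \<Rightarrow> nat \<Rightarrow> complex) \<Rightarrow> (nat \<Rightarrow> nat \<Rightarrow> nat \<Rightarrow> complex) \<Rightarrow> bool" where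
  "exterior \<equiv> exterior_solution hbar \<tau> \<rho>_inf B1_inf B2_inf V_inf x J y K"

abbreviation S :: "(nat \<Rightarrow> nat \<Rightarrow> complex) \<Rightarrow> nat \<Rightarrow> nat \<Rightarrow> complex" where
  "S \<equiv> S_ref hbar \<tau> \<rho>_inf B1_inf B2_inf V_inf x J y K"

lemma h_pos: "0 < h"
  using strict_monoD[OF x_mono, of "J - 1" J] J_pos by (simp add: h_def mesh_step_def)

lemma \<kappa>_pos: "0 < \<kappa>"
  using hbar B1_inf h_pos by (simp add: \<kappa>_def)

lemma a_pos: "0 < a"
  using hbar \<tau> \<rho>_inf by (simp add: a_def)

lemma step_uniform: "J \<le> j \<Longrightarrow> mesh_step x j = h"
  unfolding h_def by (rule uniform)

lemma mid_uniform: "J \<le> j \<Longrightarrow> mid_step x j = h"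
  using step_uniform[of j] step_uniform[of "j + 1"] by (simp add: mid_step_def)

lemma exterior_H_eq:
  assumes "J \<le> j"
  shows "- of_real (hbar\<^sup>2 / 2) * (of_real B1_inf * along_x (dhat x) (along_x (dbar x) W) j k
      + of_real B2_inf * along_y (dhat y) (along_y (dbar y) W) j k) + of_real V_inf * W j k
      = exterior_H W j k"
proof -
  have "along_x (dhat x) (along_x (dbar x) W) j k = (W (j + 1) k - 2 * W j k + W (j - 1) k) / of_real (h\<^sup>2)"
    using assms
    by (simp add: along_x_def dhat_def dbar_def step_uniform mid_uniform power2_eq_square
        flip: diff_divide_distrib)
  moreover have "along_y (dhat y) (along_y (dbar y) W) j k = dhat y (dbar y (W j)) k"
    by (simp add: along_y_def[abs_def])
  moreover have "complex_of_real \<kappa> = of_real (hbar\<^sup>2 / 2) * of_real B1_inf / of_real (h\<^sup>2)"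
    by (simp add: \<kappa>_def)
  moreover have "- A * (b1 * (D / H) + b2 * L) + v = - (A * b1 / H) * D + (- (A * b2) * L + v)"
    for A b1 D H b2 L v :: complex
    by (simp add: algebra_simps)
  ultimately show ?thesis
    by (simp only: half_line_H_def transverse_def \<beta>_def of_real_minus of_real_mult)
qed

lemma exterior_iff:
  "exterior \<Phi> U \<longleftrightarrow>
     (\<forall>m. summable (\<lambda>j. (nrm (U m (J - 1 + j)))\<^sup>2)) \<and>
     (\<forall>m\<ge>1. \<forall>j\<ge>J. \<forall>k\<in>{1..<K}.
        \<i> * of_real a * (U m j k - U (m - 1) j k) = exterior_H (time_mean U m) j k) \<and>
     (\<forall>m. \<forall>j\<ge>J - 1. U m j 0 = 0 \<and> U m j K = 0) \<and>
     (\<forall>j\<ge>J - 1. \<forall>k\<le>K. U 0 j k = 0) \<and>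
     (\<forall>m\<ge>1. \<forall>k\<le>K. U m J k = \<Phi> m k)"
proof -
  have rate: "\<i> * of_real (hbar * \<rho>_inf) * ((p - q) / of_real \<tau>) = \<i> * of_real a * (p - q)"
    for p q :: complex
    by (simp add: a_def)
  have eq: "\<i> * of_real (hbar * \<rho>_inf) * ((U m j k - U (m - 1) j k) / of_real \<tau>)
        = - of_real (hbar\<^sup>2 / 2) * (of_real B1_inf * along_x (dhat x) (along_x (dbar x) (time_mean U m)) j k
          + of_real B2_inf * along_y (dhat y) (along_y (dbar y) (time_mean U m)) j k)
          + of_real V_inf * time_mean U m j k
      \<longleftrightarrow> \<i> * of_real a * (U m j k - U (m - 1) j k) = exterior_H (time_mean U m) j k"
    if "J \<le> j" for m j k
    by (simp only: rate exterior_H_eq[OF that, of "time_mean U m" k])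
  show ?thesis
    unfolding exterior_solution_def Let_def
    by (intro conj_cong refl all_cong1 imp_cong ball_cong eq)
qed

lemma exteriorD:
  assumes "exterior \<Phi> U"
  shows "summable (\<lambda>j. (nrm (U m (J - 1 + j)))\<^sup>2)"
    and "1 \<le> m \<Longrightarrow> J \<le> j \<Longrightarrow> k \<in> {1..<K} \<Longrightarrow>
      \<i> * of_real a * (U m j k - U (m - 1) j k) = exterior_H (time_mean U m) j k"
    and "J - 1 \<le> j \<Longrightarrow> U m j 0 = 0" "J - 1 \<le> j \<Longrightarrow> U m j K = 0"
    and "J - 1 \<le> j \<Longrightarrow> k \<le> K \<Longrightarrow> U 0 j k = 0"
    and "1 \<le> m \<Longrightarrow> k \<le> K \<Longrightarrow> U m J k = \<Phi> m k"
  using assms unfolding exterior_iff by blast+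

lemma exterior_diff:
  assumes U: "exterior \<Phi> U" and U': "exterior \<Phi>' U'"
  shows "exterior (\<lambda>m k. \<Phi> m k - \<Phi>' m k) (\<lambda>m j k. U m j k - U' m j k)"
  unfolding exterior_iff
proof (intro conjI allI impI ballI)
  fix m
  show "summable (\<lambda>j. (nrm (\<lambda>k. U m (J - 1 + j) k - U' m (J - 1 + j) k))\<^sup>2)"
    by (rule summable_nrm_diff[OF exteriorD(1)[OF U] exteriorD(1)[OF U']])
next
  fix m j k assume m: "1 \<le> (m :: nat)" "J \<le> j" "k \<in> {1..<K}"
  have "time_mean (\<lambda>m j k. U m j k - U' m j k) m = (\<lambda>j k. time_mean U m j k - time_mean U' m j k)"
    by (intro ext) (simp add: sbar_def diff_divide_distrib add_divide_distrib)
  then show "\<i> * of_real a * (U m j k - U' m j k - (U (m - 1) j k - U' (m - 1) j k))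
      = exterior_H (time_mean (\<lambda>m j k. U m j k - U' m j k) m) j k"
    by (simp only: half_line_H_diff flip: exteriorD(2)[OF U m] exteriorD(2)[OF U' m])
       (simp add: algebra_simps)
qed (simp_all add: exteriorD(3-6)[OF U] exteriorD(3-6)[OF U'])

text \<open>  The mass strictly beyond \<open>x J\<close>, up to the constant factor \<open>\<rho>_inf h\<close>.\<close>

definition exterior_mass :: "(nat \<Rightarrow> nat \<Rightarrow> nat \<Rightarrow> complex) \<Rightarrow> nat \<Rightarrow> real" where
  "exterior_mass U m = (\<Sum>j. (nrm (U m (J + (j + 1))))\<^sup>2)"

lemma exterior_summable:
  assumes "exterior \<Phi> U"
  shows "summable (\<lambda>j. (nrm (U m (J + (j + i))))\<^sup>2)"
proof -
  have "summable (\<lambda>j. (nrm (U m (J - 1 + j)))\<^sup>2)" by (rule exteriorD(1)[OF assms])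
  then have "summable (\<lambda>j. (nrm (U m (J - 1 + (j + (i + 1)))))\<^sup>2)"
    by (subst summable_iff_shift[where f = "\<lambda>j. (nrm (U m (J - 1 + j)))\<^sup>2"])
  then show ?thesis using J_pos by (simp add: algebra_simps)
qed

text \<open>  The pairing of \<open>U m j - U (m - 1) j\<close> with the mean of the two has half the difference of the
  squared norms as its real part.\<close>

lemma exterior_row_balance:
  assumes U: "exterior \<Phi> U" and m: "1 \<le> m" and j: "J \<le> j"
  shows "a / 2 * ((nrm (U m j))\<^sup>2 - (nrm (U (m - 1) j))\<^sup>2)
    = Im (ip (exterior_H (time_mean U m) j) (time_mean U m j))"
proof -
  have "ip (exterior_H (time_mean U m) j) (time_mean U m j)
      = ip (\<lambda>k. \<i> * of_real a * (U m j k - U (m - 1) j k)) (\<lambda>k. (U m j k + U (m - 1) j k) / 2)"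
    by (rule ip_cong) (simp_all only: exteriorD(2)[OF U m j] sbar_def add.commute)
  then show ?thesis
    unfolding ip_scale using Re_ip_diff_mean[of "U m j" "U (m - 1) j"] by simp
qed

lemma time_mean_edge:
  assumes "exterior \<Phi> U" "J - 1 \<le> j"
  shows "time_mean U m j 0 = 0" "time_mean U m j K = 0"
  using exteriorD(3,4)[OF assms(1)] assms(2) by (simp_all add: sbar_def)

text \<open>  The half-line that starts at \<open>x J\<close> exchanges mass only through its first column.\<close>

lemma exterior_mass_balance:
  assumes U: "exterior \<Phi> U" and m: "1 \<le> m"
  shows "a / 2 * (exterior_mass U m - exterior_mass U (m - 1)) = \<kappa> * flux (time_mean U m) J"
proof -
  let ?W = "\<lambda>j. time_mean U m (J + j)"
  have "summable (\<lambda>j. (nrm (\<lambda>k. 1 / 2 * (U (m - 1) (J + j) k + U m (J + j) k)))\<^sup>2)"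
    using exterior_summable[OF U, of _ 0] by (intro summable_nrm_scale summable_nrm_add) simp_all
  then have "summable (\<lambda>j. (nrm (?W j))\<^sup>2)" by (simp add: sbar_def)
  then have "(\<lambda>j. Im (ip (exterior_H ?W (j + 1)) (?W (j + 1)))) sums (\<kappa> * flux ?W 0)"
    using time_mean_edge[OF U] by (intro Im_ip_half_line_H_sums) simp_all
  moreover have "exterior_H ?W (j + 1) = exterior_H (time_mean U m) (J + (j + 1))" for j
    by (intro ext) (simp add: half_line_H_def)
  moreover have "flux ?W 0 = flux (time_mean U m) J" by (simp add: flux_def)
  ultimately have "(\<lambda>j. a / 2 * ((nrm (U m (J + (j + 1))))\<^sup>2 - (nrm (U (m - 1) (J + (j + 1))))\<^sup>2))
      sums (\<kappa> * flux (time_mean U m) J)"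
    by (simp only: exterior_row_balance[OF U m le_add1])
  moreover have "(\<lambda>j. a / 2 * ((nrm (U m (J + (j + 1))))\<^sup>2 - (nrm (U (m - 1) (J + (j + 1))))\<^sup>2))
      sums (a / 2 * (exterior_mass U m - exterior_mass U (m - 1)))"
    unfolding exterior_mass_def
    by (intro sums_mult sums_diff summable_sums exterior_summable[OF U])
  ultimately show ?thesis by (rule sums_unique2[symmetric])
qed

text \<open>  The flux \<open>\<phi> J + \<phi> (J - 1)\<close> seen by the central difference is \<open>2 \<phi> J\<close>, which feeds the columns beyond
  \<open>J\<close>, plus \<open>\<phi> (J - 1) - \<phi> J\<close>, which feeds column \<open>J\<close> itself.\<close>

lemma exterior_flux_balance:
  assumes U: "exterior \<Phi> U" and m: "1 \<le> m"
  shows "4 * h * \<kappa> / a * Im (ip (\<lambda>k. dcirc x (\<lambda>j. time_mean U m j k) J) (time_mean U m J))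
    = (2 * exterior_mass U m + (nrm (U m J))\<^sup>2)
      - (2 * exterior_mass U (m - 1) + (nrm (U (m - 1) J))\<^sup>2)"
proof -
  let ?W = "time_mean U m"
  have "ip (\<lambda>k. dcirc x (\<lambda>j. ?W j k) J) (?W J)
      = (ip (?W (J + 1)) (?W J) - ip (?W (J - 1)) (?W J)) / of_real (2 * h)"
    unfolding dcirc_def by (simp only: mid_uniform[OF order_refl] ip_divide ip_diff)
  moreover have "Im (ip (?W (J - 1)) (?W J)) = - flux ?W (J - 1)"
    using J_pos ip_commute[of "?W (J - 1)" "?W J"] by (simp add: flux_def)
  ultimately have "2 * h * Im (ip (\<lambda>k. dcirc x (\<lambda>j. ?W j k) J) (?W J)) = flux ?W J + flux ?W (J - 1)"
    using h_pos by (simp add: Im_divide_of_real flux_def del: of_real_mult)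
  moreover have "a / 2 * ((nrm (U m J))\<^sup>2 - (nrm (U (m - 1) J))\<^sup>2) = \<kappa> * (flux ?W (J - 1) - flux ?W J)"
    unfolding exterior_row_balance[OF U m order_refl]
    using time_mean_edge[OF U] J_pos by (intro Im_ip_half_line_H) simp_all
  ultimately have "2 * (\<kappa> * (2 * h * Im (ip (\<lambda>k. dcirc x (\<lambda>j. ?W j k) J) (?W J))))
      = a * ((2 * exterior_mass U m + (nrm (U m J))\<^sup>2)
        - (2 * exterior_mass U (m - 1) + (nrm (U (m - 1) J))\<^sup>2))"
    using exterior_mass_balance[OF U m] by (simp add: algebra_simps)
  then show ?thesis using a_pos by (simp add: field_simps)
qed

lemma exterior_initial:
  assumes "exterior \<Phi> U"
  shows "J - 1 \<le> j \<Longrightarrow> nrm (U 0 j) = 0" "exterior_mass U 0 = 0"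
proof -
  have z: "nrm (U 0 j) = 0" if "J - 1 \<le> j" for j
    using nrm_cong[of "U 0 j" "\<lambda>k. 0"] exteriorD(5)[OF assms that] by simp
  then show "J - 1 \<le> j \<Longrightarrow> nrm (U 0 j) = 0" .
  show "exterior_mass U 0 = 0" using z by (simp add: exterior_mass_def)
qed

lemma exterior_dissipative:
  assumes U: "exterior \<Phi> U"
  shows "0 \<le> (\<Sum>m = 1..M. Im (ip (\<lambda>k. dcirc x (\<lambda>j. time_mean U m j k) J) (time_mean U m J)))"
proof -
  define Q where "Q m = 2 * exterior_mass U m + (nrm (U m J))\<^sup>2" for m
  have "4 * h * \<kappa> / a * (\<Sum>m = 1..M. Im (ip (\<lambda>k. dcirc x (\<lambda>j. time_mean U m j k) J) (time_mean U m J)))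
      = (\<Sum>m = 1..M. Q m - Q (m - 1))"
    unfolding sum_distrib_left Q_def by (intro sum.cong refl exterior_flux_balance[OF U]) simp
  also have "\<dots> = Q M - Q 0" by (induction M) auto
  also have "Q 0 = 0" using exterior_initial[OF U] by (simp add: Q_def)
  also have "0 \<le> Q M - 0"
    unfolding Q_def exterior_mass_def
    using suminf_nonneg[OF exterior_summable[OF U, of M 1]] by simp
  finally have "4 * h * \<kappa> / a * 0
      \<le> 4 * h * \<kappa> / a * (\<Sum>m = 1..M. Im (ip (\<lambda>k. dcirc x (\<lambda>j. time_mean U m j k) J) (time_mean U m J)))"
    by simp
  then show ?thesis
    by (rule mult_left_le_imp_le) (use a_pos h_pos \<kappa>_pos in simp)
qed

text \<open>  No mass enters through a zero boundary value, so the solution vanishes beyond \<open>x J\<close>; the equation in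
  column \<open>J\<close> then forces the mean in column \<open>J - 1\<close> to vanish too.\<close>

lemma exterior_zero_data:
  assumes U: "exterior \<Phi> U" and zero: "\<And>m k. 1 \<le> m \<Longrightarrow> k \<le> K \<Longrightarrow> \<Phi> m k = 0"
    and m: "1 \<le> m" and k: "k \<in> {1..<K}"
  shows "dcirc x (\<lambda>j. time_mean U m j k) J = 0"
proof -
  have UJ: "U n J k = 0" if "k \<le> K" for n k
    using exteriorD(5)[OF U, of J k] exteriorD(6)[OF U, of n k] zero that by (cases "n = 0") auto
  then have WJ: "time_mean U n J k = 0" if "k \<le> K" for n k using that by (simp add: sbar_def)
  have rho_norm: "exterior_mass U n = 0" for n
  proof (induction n)
    case 0
    then show ?case using exterior_initial[OF U] by simp
  next
    case (Suc n)
    have "ip (time_mean U (Suc n) (J + 1)) (time_mean U (Suc n) J) = 0"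
      using WJ by (simp add: inner_y_def)
    then show ?case
      using Suc exterior_mass_balance[OF U, of "Suc n"] a_pos by (simp add: flux_def)
  qed
  have "U n (J + 1) k = 0" for n
  proof -
    have "(nrm (U n (J + (0 + 1))))\<^sup>2 \<le> exterior_mass U n"
      unfolding exterior_mass_def
      using sum_le_suminf[OF exterior_summable[OF U, of n 1], of "{0}"] by simp
    then have "nrm (U n (J + 1)) = 0" using rho_norm by simp
    then show ?thesis using k by (rule nrm_eq_0_D)
  qed
  then have W1: "time_mean U m (J + 1) k = 0" by (simp add: sbar_def)
  have "\<i> * of_real a * (U m J k - U (m - 1) J k) = exterior_H (time_mean U m) J k"
    by (rule exteriorD(2)[OF U m order_refl k])
  moreover have "transverse \<beta> V_inf (time_mean U m J) k = 0"
    using transverse_cong[of "time_mean U m J" "\<lambda>k. 0"] WJ k transverse_zero by simp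
  then have "exterior_H (time_mean U m) J k = - of_real \<kappa> * time_mean U m (J - 1) k"
    using WJ[of k m] k W1 by (simp only: half_line_H_def) simp
  ultimately have "time_mean U m (J - 1) k = 0"
    using UJ k \<kappa>_pos by simp
  then show ?thesis using W1 \<kappa>_pos by (simp add: dcirc_def)
qed

lemma S_eq:
  assumes U: "exterior \<Phi> U" and m: "1 \<le> m" and k: "k \<in> {1..<K}"
  shows "S \<Phi> m k = dcirc x (\<lambda>j. time_mean U m j k) J"
  unfolding S_ref_def
proof (rule the_equality)
  show "\<exists>U'. exterior \<Phi> U' \<and> dcirc x (\<lambda>j. time_mean U m j k) J = dcirc x (\<lambda>j. time_mean U' m j k) J"
    using U by blast
  fix s
  assume "\<exists>U'. exterior \<Phi> U' \<and> s = dcirc x (\<lambda>j. time_mean U' m j k) J"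
  then obtain U' where U': "exterior \<Phi> U'" "s = dcirc x (\<lambda>j. time_mean U' m j k) J" by blast
  have "dcirc x (\<lambda>j. time_mean (\<lambda>m j k. U' m j k - U m j k) m j k) J = 0"
    by (rule exterior_zero_data[OF exterior_diff[OF U'(1) U] _ m k]) simp
  then show "s = dcirc x (\<lambda>j. time_mean U m j k) J"
    unfolding U'(2) by (simp add: dcirc_def sbar_def diff_divide_distrib add_divide_distrib algebra_simps)
qed

text \<open>  What one time level of an exterior solution hands to the next.\<close>

definition exterior_level :: "(nat \<Rightarrow> nat \<Rightarrow> complex) \<Rightarrow> bool" where
  "exterior_level u \<longleftrightarrow> summable (\<lambda>j. (nrm (u (J - 1 + j)))\<^sup>2) \<and>
     (\<forall>j\<ge>J - 1. \<forall>k. k \<notin> {1..<K} \<longrightarrow> u j k = 0)"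

text \<open>  In terms of \<open>w = (u + v) / 2\<close> the step reads \<open>(2 \<i> a - H) w = 2 \<i> a u\<close>. From column \<open>J + 1\<close> on this is
  a resolvent equation with boundary value \<open>(u J + g) / 2\<close>; the equation in column \<open>J\<close> contains no
  other unknown than \<open>w (J - 1)\<close>, and defines it.\<close>

lemma exterior_time_step:
  assumes u: "exterior_level u" and g: "\<And>k. k \<notin> {1..<K} \<Longrightarrow> g k = 0"
  shows "\<exists>v. exterior_level v \<and> v J = g \<and> (\<forall>j\<ge>J. \<forall>k\<in>{1..<K}.
    \<i> * of_real a * (v j k - u j k) = exterior_H (\<lambda>j k. (u j k + v j k) / 2) j k)"
proof -
  let ?M = "transverse \<beta> V_inf"
  have "summable (\<lambda>j. (nrm (u (J - 1 + j)))\<^sup>2)" using u by (simp add: exterior_level_def)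
  then have "summable (\<lambda>j. (nrm (u (J - 1 + (j + 1))))\<^sup>2)"
    by (subst summable_iff_shift[where f = "\<lambda>j. (nrm (u (J - 1 + j)))\<^sup>2"])
  then have u_sum: "summable (\<lambda>j. (nrm (u (J + j)))\<^sup>2)" using J_pos by (simp add: algebra_simps)
  have "summable (\<lambda>j. (nrm (\<lambda>k. \<i> * of_real (2 * a) * u (J + j) k))\<^sup>2)"
    by (rule summable_nrm_scale[OF u_sum])
  then have "summable (\<lambda>j. (nrm ((\<lambda>j k. \<i> * of_real (2 * a) * u (J + j) k) (j + 1)))\<^sup>2)"
    by (subst summable_iff_shift[where f = "\<lambda>j. (nrm (\<lambda>k. \<i> * of_real (2 * a) * u (J + j) k))\<^sup>2"])
  note G = this
  have g': "(u J k + g k) / 2 = 0" if "k \<notin> {1..<K}" for k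
    using u g[OF that] that by (simp add: exterior_level_def)
  have pos: "0 \<le> \<kappa>" "0 < 2 * a" using \<kappa>_pos a_pos by auto
  obtain w where w: "finite_energy w" "w 0 = (\<lambda>k. (u J k + g k) / 2)"
    and eq: "\<And>j k. 1 \<le> j \<Longrightarrow> k \<in> {1..<K} \<Longrightarrow>
      \<i> * of_real (2 * a) * w j k - exterior_H w j k = \<i> * of_real (2 * a) * u (J + j) k"
    using half_line_resolvent[where g = "\<lambda>k. (u J k + g k) / 2" and b = \<beta> and V = V_inf,
        OF pos g' G] by blast
  define W where "W j k = (if J \<le> j then w (j - J) k else if k \<in> {1..<K} then
      2 * w 0 k - w 1 k + (?M (w 0) k - \<i> * of_real a * (g k - u J k)) / of_real \<kappa> else 0)" for j k
  define v where "v j k = 2 * W j k - u j k" for j k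
  have mean: "(\<lambda>j k. (u j k + v j k) / 2) = W" by (intro ext) (simp add: v_def)
  show ?thesis
  proof (intro exI[of _ v] conjI allI impI ballI)
    show vJ: "v J = g" by (intro ext) (simp add: v_def W_def w(2) add_divide_distrib)
    have "summable (\<lambda>j. (nrm (\<lambda>k. 2 * w j k - u (J + j) k))\<^sup>2)"
      using finite_energyD(4)[OF w(1)] u_sum by (intro summable_nrm_diff summable_nrm_scale)
    moreover have "(\<lambda>k. 2 * w j k - u (J + j) k) = v (J - 1 + (j + 1))" for j
      using J_pos by (intro ext) (simp add: v_def W_def)
    ultimately have "summable (\<lambda>j. (nrm (v (J - 1 + (j + 1))))\<^sup>2)" by simp
    then have "summable (\<lambda>j. (nrm (v (J - 1 + j)))\<^sup>2)"
      by (subst (asm) summable_iff_shift[where f = "\<lambda>j. (nrm (v (J - 1 + j)))\<^sup>2"])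
    moreover have "v j k = 0" if "J - 1 \<le> j" "k \<notin> {1..<K}" for j k
      using u that finite_energyD(1)[OF w(1)] by (auto simp: exterior_level_def v_def W_def)
    ultimately show "exterior_level v" by (simp add: exterior_level_def)
    fix j k assume jk: "J \<le> j" "k \<in> {1..<K}"
    show "\<i> * of_real a * (v j k - u j k) = exterior_H (\<lambda>j k. (u j k + v j k) / 2) j k"
    proof (cases "j = J")
      case True
      have row: "W J = w 0" "W (J + 1) = w 1" by (simp_all add: W_def[abs_def])
      have "\<not> J \<le> J - 1" using J_pos by linarith
      then have "of_real \<kappa> * W (J - 1) k = of_real \<kappa> * (2 * w 0 k - w 1 k)
          + (?M (w 0) k - \<i> * of_real a * (g k - u J k))"
        using jk \<kappa>_pos \<open>\<not> J \<le> J - 1\<close> by (simp add: W_def distrib_left)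
      then show ?thesis
        unfolding mean True vJ half_line_H_def row by (simp add: algebra_simps)
    next
      case False
      then have "exterior_H W j k = exterior_H w (j - J) k"
        using jk by (simp add: half_line_H_def W_def[abs_def] Suc_diff_le)
      moreover have "\<i> * of_real (2 * a) * w (j - J) k - exterior_H w (j - J) k
          = \<i> * of_real (2 * a) * u j k"
        using eq[of "j - J" k] jk False by simp
      ultimately show ?thesis
        unfolding mean using jk by (simp add: v_def W_def algebra_simps)
    qed
  qed
qed

lemma exterior_exists:
  assumes \<Phi>: "\<And>m. 1 \<le> m \<Longrightarrow> \<Phi> m 0 = 0 \<and> \<Phi> m K = 0"
  shows "\<exists>U. exterior \<Phi> U"
proof -
  define P where "P n u \<longleftrightarrow> exterior_level u \<and> (n = 0 \<longrightarrow> u = (\<lambda>j k. 0)) \<and>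
      (1 \<le> n \<longrightarrow> (\<forall>k\<le>K. u J k = \<Phi> n k))" for n u
  define Q where "Q n u v \<longleftrightarrow> (\<forall>j\<ge>J. \<forall>k\<in>{1..<K}.
      \<i> * of_real a * (v j k - u j k) = exterior_H (\<lambda>j k. (u j k + v j k) / 2) j k)"
    for n :: nat and u v :: "nat \<Rightarrow> nat \<Rightarrow> complex"
  have "\<exists>U. \<forall>n. P n (U n) \<and> Q n (U n) (U (Suc n))"
  proof (rule dependent_nat_choice)
    show "\<exists>u. P 0 u" by (simp add: P_def exterior_level_def)
    fix u n assume "P n u"
    then have u: "exterior_level u" by (simp add: P_def)
    define g where "g k = (if k \<in> {1..<K} then \<Phi> (Suc n) k else 0)" for k
    have "g k = 0" if "k \<notin> {1..<K}" for k using that by (simp only: g_def if_False)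
    from exterior_time_step[where g = g, OF u this]
    obtain v where v: "exterior_level v" "v J = g" "Q n u v"
      unfolding Q_def by blast
    have "g k = \<Phi> (Suc n) k" if "k \<le> K" for k
      using \<Phi>[of "Suc n"] that by (cases "k = 0"; cases "k = K") (auto simp: g_def)
    then show "\<exists>v. P (Suc n) v \<and> Q n u v"
      using v by (intro exI[of _ v]) (auto simp: P_def)
  qed
  then obtain U where U: "\<And>n. P n (U n)" "\<And>n. Q n (U n) (U (Suc n))" by blast
  have "exterior \<Phi> U"
    unfolding exterior_iff
  proof (intro conjI allI impI ballI)
    fix m j k assume m: "1 \<le> (m :: nat)" and jk: "J \<le> j" "k \<in> {1..<K}"
    then obtain n where n: "m = Suc n" by (cases m) auto
    have "time_mean U m = (\<lambda>j k. (U n j k + U (Suc n) j k) / 2)"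
      by (intro ext) (simp add: sbar_def n)
    then show "\<i> * of_real a * (U m j k - U (m - 1) j k) = exterior_H (time_mean U m) j k"
      using U(2)[of n] jk by (simp add: Q_def n)
  qed (use U(1) in \<open>auto simp: P_def exterior_level_def\<close>)
  then show ?thesis by blast
qed

lemma S_dissipative:
  assumes \<Phi>: "\<And>k. k \<in> {1..<K} \<Longrightarrow> \<Phi> 0 k = 0" "\<And>m. 1 \<le> m \<Longrightarrow> \<Phi> m 0 = 0 \<and> \<Phi> m K = 0"
  shows "0 \<le> (\<Sum>m = 1..M. Im (ip (S \<Phi> m) (\<lambda>k. sbar (\<lambda>n. \<Phi> n k) m)))"
proof -
  obtain U where U: "exterior \<Phi> U" using exterior_exists[of \<Phi>] \<Phi>(2) by blast
  have UJ: "U n J k = \<Phi> n k" if "k \<in> {1..<K}" for n k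
    using exteriorD(5)[OF U, of J k] exteriorD(6)[OF U, of n k] \<Phi>(1) that by (cases "n = 0") auto
  have "(\<Sum>m = 1..M. Im (ip (S \<Phi> m) (\<lambda>k. sbar (\<lambda>n. \<Phi> n k) m)))
      = (\<Sum>m = 1..M. Im (ip (\<lambda>k. dcirc x (\<lambda>j. time_mean U m j k) J) (time_mean U m J)))"
    using S_eq[OF U] UJ
    by (intro sum.cong refl arg_cong[where f = Im] ip_cong) (auto simp: sbar_def)
  then show ?thesis using exterior_dissipative[OF U] by simp
qed

text \<open>  The scheme leaves \<open>\<Psi>t 0\<close> unspecified, whereas dissipativity needs zero data at the initial time;
  this lemma allows one to put zero there.\<close>

lemma S_ignores_initial:
  assumes "\<And>m. 1 \<le> m \<Longrightarrow> \<Phi> m = \<Phi>' m"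
  shows "S \<Phi> = S \<Phi>'"
proof -
  have "exterior \<Phi> = exterior \<Phi>'"
    unfolding exterior_iff[abs_def] using assms by (intro ext) auto
  then show ?thesis by (intro ext) (simp add: S_ref_def)
qed

end

section \<open>The Hamiltonian on the bounded mesh\<close>

lemma sum_dhat:
  fixes g a :: "nat \<Rightarrow> complex"
  assumes "a 0 = 0" "1 \<le> N"
    and "\<And>j. j \<in> {1..<N} \<Longrightarrow> mid_step x j \<noteq> 0" "\<And>j. j \<in> {1..N} \<Longrightarrow> mesh_step x j \<noteq> 0"
  shows "(\<Sum>j = 1..<N. dhat x g j * a j * of_real (mid_step x j))
    = g N * a N - (\<Sum>j = 1..N. g j * dbar x a j * of_real (mesh_step x j))"
proof -
  have "(\<Sum>j = 1..<N. dhat x g j * a j * of_real (mid_step x j)) = (\<Sum>j = 1..<N. (g (j + 1) - g j) * a j)"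
    by (intro sum.cong refl) (use assms(3) in \<open>force simp: dhat_def\<close>)
  also have "\<dots> = g N * a N - (\<Sum>j = 1..N. g j * (a j - a (j - 1)))"
    by (rule summation_by_parts) fact+
  also have "(\<Sum>j = 1..N. g j * (a j - a (j - 1))) = (\<Sum>j = 1..N. g j * dbar x a j * of_real (mesh_step x j))"
    by (intro sum.cong refl) (use assms(4) in \<open>force simp: dbar_def\<close>)
  finally show ?thesis .
qed

text \<open>  The averages satisfy \<open>(shat w, a) = (w, sbar a)\<close>, where a nonzero last value of \<open>a\<close> contributes a
  correction.\<close>

lemma sum_shat:
  fixes w a :: "nat \<Rightarrow> complex"
  assumes "a 0 = 0" "1 \<le> N" and "\<And>j. j \<in> {1..<N} \<Longrightarrow> mid_step x j \<noteq> 0"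
  shows "(\<Sum>j = 1..<N. shat x w j * a j * of_real (mid_step x j))
    = (\<Sum>j = 1..N. w j * sbar a j * of_real (mesh_step x j)) - w N * a N * of_real (mesh_step x N) / 2"
proof -
  define g where "g j = of_real (mesh_step x j) * w j / 2" for j
  have "(\<Sum>j = 1..<N. shat x w j * a j * of_real (mid_step x j)) = (\<Sum>j = 1..<N. (g j + g (j + 1)) * a j)"
    by (intro sum.cong refl) (use assms(3) in \<open>force simp: shat_def g_def field_simps\<close>)
  also have "\<dots> = (\<Sum>j = 1..N. g j * (a (j - 1) + a j)) - g N * a N"
    using assms(2)
  proof (induction N rule: dec_induct)
    case base
    then show ?case using assms(1) by simp
  next
    case (step n)
    then show ?case by (simp add: algebra_simps)
  qed
  also have "\<dots> = (\<Sum>j = 1..N. w j * sbar a j * of_real (mesh_step x j)) - w N * a N * of_real (mesh_step x N) / 2"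
    by (simp add: g_def sbar_def mult_ac)
  finally show ?thesis .
qed

context exterior_mesh
begin

lemma x_step_pos: "1 \<le> j \<Longrightarrow> 0 < mesh_step x j"
  using strict_monoD[OF x_mono, of "j - 1" j] by (simp add: mesh_step_def)

lemma x_mid_pos: "1 \<le> j \<Longrightarrow> 0 < mid_step x j"
  using x_step_pos[of j] x_step_pos[of "j + 1"] by (simp add: mid_step_def)

abbreviation interior_pairing :: "(nat \<Rightarrow> nat \<Rightarrow> complex) \<Rightarrow> (nat \<Rightarrow> nat \<Rightarrow> complex) \<Rightarrow> complex" where
  "interior_pairing U W \<equiv>
     \<Sum>j = 1..<J. \<Sum>k = 1..<K. U j k * cnj (W j k) * of_real (mid_step x j * mid_step y k)"

lemma weighted_sum_swap:
  fixes f :: "nat \<Rightarrow> nat \<Rightarrow> complex"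
  shows "(\<Sum>k\<in>L. (\<Sum>j\<in>I. f j k * p j) * q k) = (\<Sum>j\<in>I. p j * (\<Sum>k\<in>L. f j k * q k))"
  unfolding sum_distrib_left sum_distrib_right by (subst sum.swap) (simp add: mult_ac)

lemma interior_pairing_swap:
  "interior_pairing U W
    = (\<Sum>k = 1..<K. (\<Sum>j = 1..<J. U j k * cnj (W j k) * of_real (mid_step x j)) * of_real (mid_step y k))"
  by (subst sum.swap) (simp add: sum_distrib_left mult_ac)

lemma cnj_dbar: "cnj (dbar z w n) = dbar z (\<lambda>i. cnj (w i)) n"
  by (simp add: dbar_def)

lemma vanishes_on_GammaD:
  assumes "vanishes_on_Gamma J K W" "j \<le> J"
  shows "W j 0 = 0" "W j K = 0"
  using assms by (auto simp: vanishes_on_Gamma_def)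

lemma sum_x_dhat:
  assumes "vanishes_on_Gamma J K W" "k \<in> {1..<K}"
  shows "(\<Sum>j = 1..<J. dhat x g j * cnj (W j k) * of_real (mid_step x j))
    = g J * cnj (W J k) - (\<Sum>j = 1..J. g j * cnj (dbar x (\<lambda>i. W i k) j) * of_real (mesh_step x j))"
  unfolding cnj_dbar
proof (rule sum_dhat)
  show "mid_step x j \<noteq> 0" if "j \<in> {1..<J}" for j using x_mid_pos[of j] that by simp
  show "mesh_step x j \<noteq> 0" if "j \<in> {1..J}" for j using x_step_pos[of j] that by simp
qed (use assms J_pos in \<open>simp_all add: vanishes_on_Gamma_def\<close>)

text \<open>  Summation by parts leaves minus a real weighted sum of squares and the boundary term at \<open>x J\<close>.\<close>

lemma Im_interior_pairing_xx:
  assumes W: "vanishes_on_Gamma J K W"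
    and b: "\<And>k. k \<in> {1..<K} \<Longrightarrow> b J k = c"
  shows "Im (interior_pairing (along_x (dhat x) (\<lambda>i l. of_real (b i l) * along_x (dbar x) W i l)) W)
    = c * Im (ip (along_x (dbar x) W J) (W J))"
proof -
  have row: "Im ((\<Sum>j = 1..<J. along_x (dhat x) (\<lambda>i l. of_real (b i l) * along_x (dbar x) W i l) j k
        * cnj (W j k) * of_real (mid_step x j)) * of_real (mid_step y k))
      = c * Im (along_x (dbar x) W J k * cnj (W J k) * of_real (mid_step y k))"
    if k: "k \<in> {1..<K}" for k
  proof -
    let ?d = "dbar x (\<lambda>i. W i k)"
    have "(\<Sum>j = 1..<J. along_x (dhat x) (\<lambda>i l. of_real (b i l) * along_x (dbar x) W i l) j k
        * cnj (W j k) * of_real (mid_step x j))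
      = of_real (b J k) * ?d J * cnj (W J k)
        - (\<Sum>j = 1..J. of_real (b j k) * ?d j * cnj (?d j) * of_real (mesh_step x j))"
      unfolding along_x_def by (rule sum_x_dhat[OF W k])
    also have "(\<Sum>j = 1..J. of_real (b j k) * ?d j * cnj (?d j) * of_real (mesh_step x j))
        = of_real (\<Sum>j = 1..J. b j k * (cmod (?d j))\<^sup>2 * mesh_step x j)"
      unfolding of_real_sum
      by (intro sum.cong refl)
         (simp add: mult.assoc complex_norm_square[symmetric] del: of_real_power)
    finally have sum: "(\<Sum>j = 1..<J. along_x (dhat x) (\<lambda>i l. of_real (b i l) * along_x (dbar x) W i l) j k
        * cnj (W j k) * of_real (mid_step x j))
      = of_real c * (?d J * cnj (W J k)) - of_real (\<Sum>j = 1..J. b j k * (cmod (?d j))\<^sup>2 * mesh_step x j)"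
      using b[OF k] by (simp add: mult.assoc)
    show ?thesis unfolding sum by (simp add: along_x_def algebra_simps del: of_real_sum)
  qed
  show ?thesis
    unfolding interior_pairing_swap inner_y_def Im_sum sum_distrib_left by (rule sum.cong[OF refl row])
qed

lemma Im_interior_pairing_yy:
  assumes W: "vanishes_on_Gamma J K W"
  shows "Im (interior_pairing (along_y (dhat y) (\<lambda>i l. of_real (b i l) * along_y (dbar y) W i l)) W) = 0"
proof -
  have "Im (\<Sum>k = 1..<K. along_y (dhat y) (\<lambda>i l. of_real (b i l) * along_y (dbar y) W i l) j k
      * cnj (W j k) * of_real (mid_step x j * mid_step y k)) = 0" if "j \<in> {1..<J}" for j
  proof -
    have "(\<Sum>k = 1..<K. along_y (dhat y) (\<lambda>i l. of_real (b i l) * along_y (dbar y) W i l) j k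
        * cnj (W j k) * of_real (mid_step x j * mid_step y k))
      = of_real (mid_step x j) * ip (dhat y (\<lambda>l. of_real (b j l) * dbar y (W j) l)) (W j)"
      by (simp add: inner_y_def along_y_def sum_distrib_left mult_ac)
    moreover have "Im (ip (dhat y (\<lambda>l. of_real (b j l) * dbar y (W j) l)) (W j)) = 0"
      using W that by (intro ip_second_difference_real) (auto simp: vanishes_on_Gamma_def)
    ultimately show ?thesis by simp
  qed
  then show ?thesis by (simp add: Im_sum)
qed

lemma y_mid_nonzero: "k \<in> {1..<K} \<Longrightarrow> mid_step y k \<noteq> 0"
  using mid_pos by fastforce

lemma y_step_nonzero: "k \<in> {1..K} \<Longrightarrow> mesh_step y k \<noteq> 0"
  using step_pos by fastforce

text \<open>  The mixed terms have no sign of their own. Summation by parts in both directions, with the average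
  and the difference exchanging their directions, brings them into forms that are conjugate to each
  other when the two coefficients agree. The boundary term vanishes with the coefficient in the last
  cells.\<close>

lemma interior_pairing_xy:
  assumes W: "vanishes_on_Gamma J K W"
    and b: "\<And>k. k \<in> {1..K} \<Longrightarrow> b J k = 0"
  shows "interior_pairing (along_x (dhat x) (along_y (shat y)
      (\<lambda>i l. of_real (b i l) * along_x sbar (along_y (dbar y) W) i l))) W
    = - (\<Sum>j = 1..J. \<Sum>k = 1..K. of_real (b j k * mesh_step x j * mesh_step y k)
          * (along_x sbar (along_y (dbar y) W) j k * cnj (along_x (dbar x) (along_y sbar W) j k)))"
  (is "?lhs = _")
proof -
  let ?p = "along_x sbar (along_y (dbar y) W)" and ?q = "along_x (dbar x) (along_y sbar W)"
  define G where "G j k = shat y (\<lambda>l. of_real (b j l) * ?p j l) k" for j k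
  have GJ: "G J k = 0" if "k \<in> {1..<K}" for k using b that by (simp add: G_def shat_def)
  have "interior_pairing (along_x (dhat x) (along_y (shat y) (\<lambda>i l. of_real (b i l) * ?p i l))) W
      = (\<Sum>k = 1..<K. (\<Sum>j = 1..<J. dhat x (\<lambda>i. G i k) j * cnj (W j k) * of_real (mid_step x j))
          * of_real (mid_step y k))"
    unfolding interior_pairing_swap by (simp add: along_x_def along_y_def G_def)
  also have "\<dots> = (\<Sum>k = 1..<K. - (\<Sum>j = 1..J. G j k * cnj (dbar x (\<lambda>i. W i k) j) * of_real (mesh_step x j))
          * of_real (mid_step y k))"
    using GJ sum_x_dhat[OF W] by (intro sum.cong refl) simp
  finally have swapped: "?lhs = - (\<Sum>j = 1..J. of_real (mesh_step x j)
      * (\<Sum>k = 1..<K. G j k * cnj (dbar x (\<lambda>i. W i k) j) * of_real (mid_step y k)))"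
    by (simp only: mult_minus_left sum_negf weighted_sum_swap)
  have row: "(\<Sum>k = 1..<K. G j k * cnj (dbar x (\<lambda>i. W i k) j) * of_real (mid_step y k))
      = (\<Sum>k = 1..K. of_real (b j k) * ?p j k * cnj (?q j k) * of_real (mesh_step y k))"
    if "j \<in> {1..J}" for j
  proof -
    let ?a = "\<lambda>k. cnj (dbar x (\<lambda>i. W i k) j)"
    have "j \<le> J" "j - 1 \<le> J" using that by auto
    then have a: "?a 0 = 0" "?a K = 0" by (simp_all add: dbar_def vanishes_on_GammaD[OF W])
    have "(\<Sum>k = 1..<K. G j k * ?a k * of_real (mid_step y k))
        = (\<Sum>k = 1..K. of_real (b j k) * ?p j k * sbar ?a k * of_real (mesh_step y k))"
      unfolding G_def using sum_shat[where a = ?a, OF a(1) K_pos y_mid_nonzero] a(2) by simp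
    moreover have "sbar ?a k = cnj (?q j k)" for k
      by (simp add: sbar_def dbar_def along_x_def along_y_def add_divide_distrib diff_divide_distrib
          mult.commute[of 2])
    ultimately show ?thesis by simp
  qed
  show ?thesis
    unfolding swapped
    by (intro arg_cong[where f = uminus] sum.cong refl) (simp only: row, simp add: sum_distrib_left mult_ac)
qed

lemma interior_pairing_yx:
  assumes W: "vanishes_on_Gamma J K W"
    and b: "\<And>k. k \<in> {1..K} \<Longrightarrow> b J k = 0"
  shows "interior_pairing (along_x (shat x) (along_y (dhat y)
      (\<lambda>i l. of_real (b i l) * along_x (dbar x) (along_y sbar W) i l))) W
    = - (\<Sum>j = 1..J. \<Sum>k = 1..K. of_real (b j k * mesh_step x j * mesh_step y k)
          * (along_x (dbar x) (along_y sbar W) j k * cnj (along_x sbar (along_y (dbar y) W) j k)))"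
  (is "?lhs = _")
proof -
  let ?p = "along_x sbar (along_y (dbar y) W)" and ?q = "along_x (dbar x) (along_y sbar W)"
  define G where "G j k = dhat y (\<lambda>l. of_real (b j l) * ?q j l) k" for j k
  have GJ: "G J k = 0" if "k \<in> {1..<K}" for k using b that by (simp add: G_def dhat_def)
  have x_sum: "(\<Sum>j = 1..<J. shat x (\<lambda>i. G i k) j * cnj (W j k) * of_real (mid_step x j))
      = (\<Sum>j = 1..J. G j k * sbar (\<lambda>i. cnj (W i k)) j * of_real (mesh_step x j))"
    if k: "k \<in> {1..<K}" for k
  proof -
    have "mid_step x j \<noteq> 0" if "j \<in> {1..<J}" for j using x_mid_pos[of j] that by simp
    then show ?thesis
      using sum_shat[where a = "\<lambda>i. cnj (W i k)" and N = J and x = x and w = "\<lambda>i. G i k"]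
        W k GJ[OF k] J_pos by (simp add: vanishes_on_Gamma_def)
  qed
  have "interior_pairing (along_x (shat x) (along_y (dhat y) (\<lambda>i l. of_real (b i l) * ?q i l))) W
      = (\<Sum>k = 1..<K. (\<Sum>j = 1..<J. shat x (\<lambda>i. G i k) j * cnj (W j k) * of_real (mid_step x j))
          * of_real (mid_step y k))"
    unfolding interior_pairing_swap by (simp add: along_x_def along_y_def G_def)
  also have "\<dots> = (\<Sum>k = 1..<K. (\<Sum>j = 1..J. G j k * sbar (\<lambda>i. cnj (W i k)) j * of_real (mesh_step x j))
          * of_real (mid_step y k))"
    using x_sum by (intro sum.cong refl) simp
  finally have swapped: "?lhs = (\<Sum>j = 1..J. of_real (mesh_step x j)
      * (\<Sum>k = 1..<K. G j k * sbar (\<lambda>i. cnj (W i k)) j * of_real (mid_step y k)))"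
    by (simp only: weighted_sum_swap)
  have row: "(\<Sum>k = 1..<K. G j k * sbar (\<lambda>i. cnj (W i k)) j * of_real (mid_step y k))
      = - (\<Sum>k = 1..K. of_real (b j k) * ?q j k * cnj (?p j k) * of_real (mesh_step y k))"
    if "j \<in> {1..J}" for j
  proof -
    let ?a = "\<lambda>k. sbar (\<lambda>i. cnj (W i k)) j"
    have "j \<le> J" "j - 1 \<le> J" using that by auto
    then have a: "?a 0 = 0" "?a K = 0" by (simp_all add: sbar_def vanishes_on_GammaD[OF W])
    have "(\<Sum>k = 1..<K. G j k * ?a k * of_real (mid_step y k))
        = - (\<Sum>k = 1..K. of_real (b j k) * ?q j k * dbar y ?a k * of_real (mesh_step y k))"
      unfolding G_def using sum_dhat[where a = ?a, OF a(1) K_pos y_mid_nonzero y_step_nonzero] a(2) by simp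
    moreover have "dbar y ?a k = cnj (?p j k)" for k
      by (simp add: sbar_def dbar_def along_x_def along_y_def add_divide_distrib diff_divide_distrib
          mult.commute[of 2])
    ultimately show ?thesis by simp
  qed
  show ?thesis
    unfolding swapped sum_negf[symmetric]
    by (intro sum.cong refl) (simp only: row, simp add: sum_distrib_left sum_negf mult_ac)
qed

text \<open>  The Hamiltonian is symmetric up to the current through the last column.\<close>

lemma Im_interior_pairing_H0:
  assumes W: "vanishes_on_Gamma J K W"
    and sym: "\<And>j k. j \<in> {1..J} \<Longrightarrow> k \<in> {1..K} \<Longrightarrow>
      at_cells x y (\<lambda>s t. B s t $ 1 $ 2) j k = at_cells x y (\<lambda>s t. B s t $ 2 $ 1) j k"
    and B12: "\<And>k. k \<in> {1..K} \<Longrightarrow> at_cells x y (\<lambda>s t. B s t $ 1 $ 2) J k = 0"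
    and B11: "\<And>k. k \<in> {1..<K} \<Longrightarrow> along_y (shat y) (at_cells x y (\<lambda>s t. B s t $ 1 $ 1)) J k = B1_inf"
  shows "Im (interior_pairing (mesh_H0 hbar x y B W) W)
    = - (hbar\<^sup>2 / 2 * B1_inf) * Im (ip (along_x (dbar x) W J) (W J))"
proof -
  define c where "c p q = at_cells x y (\<lambda>s t. B s t $ p $ q)" for p q
  define T1 where "T1 = along_x (dhat x) (\<lambda>i l. of_real (along_y (shat y) (c 1 1) i l) * along_x (dbar x) W i l)"
  define T2 where "T2 = along_x (dhat x) (along_y (shat y)
      (\<lambda>i l. of_real (c 1 2 i l) * along_x sbar (along_y (dbar y) W) i l))"
  define T3 where "T3 = along_x (shat x) (along_y (dhat y)
      (\<lambda>i l. of_real (c 2 1 i l) * along_x (dbar x) (along_y sbar W) i l))"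
  define T4 where "T4 = along_y (dhat y) (\<lambda>i l. of_real (along_x (shat x) (c 2 2) i l) * along_y (dbar y) W i l)"
  define c0 where "c0 = complex_of_real (- (hbar\<^sup>2 / 2))"
  have "mesh_H0 hbar x y B W j k = c0 * (T1 j k + T2 j k + T3 j k + T4 j k)" for j k
    by (simp only: mesh_H0_def Let_def T1_def T2_def T3_def T4_def c_def c0_def of_real_minus)
  then have pointwise: "mesh_H0 hbar x y B W j k * v * w
      = c0 * (T1 j k * v * w) + (c0 * (T2 j k * v * w) + c0 * (T3 j k * v * w)) + c0 * (T4 j k * v * w)"
    for j k v w
    by (simp add: algebra_simps)
  have "interior_pairing (mesh_H0 hbar x y B W) W = c0 * interior_pairing T1 W
      + c0 * (interior_pairing T2 W + interior_pairing T3 W) + c0 * interior_pairing T4 W"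
    by (simp only: pointwise sum.distrib sum_distrib_left distrib_left)
  moreover have "Im (interior_pairing T1 W) = B1_inf * Im (ip (along_x (dbar x) W J) (W J))"
    unfolding T1_def by (rule Im_interior_pairing_xx[OF W]) (simp add: c_def B11)
  moreover have "Im (interior_pairing T4 W) = 0"
    unfolding T4_def by (rule Im_interior_pairing_yy[OF W])
  moreover have "Im (interior_pairing T2 W + interior_pairing T3 W) = 0"
  proof -
    let ?p = "along_x sbar (along_y (dbar y) W)" and ?q = "along_x (dbar x) (along_y sbar W)"
    let ?r = "\<lambda>j k. of_real (c 1 2 j k * mesh_step x j * mesh_step y k) :: complex"
    have "interior_pairing T2 W = - (\<Sum>j = 1..J. \<Sum>k = 1..K. ?r j k * (?p j k * cnj (?q j k)))"
      unfolding T2_def by (rule interior_pairing_xy[OF W]) (simp add: c_def B12)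
    moreover have "interior_pairing T3 W = - (\<Sum>j = 1..J. \<Sum>k = 1..K. ?r j k * (?q j k * cnj (?p j k)))"
    proof -
      have "interior_pairing T3 W = - (\<Sum>j = 1..J. \<Sum>k = 1..K.
          of_real (c 2 1 j k * mesh_step x j * mesh_step y k) * (?q j k * cnj (?p j k)))"
        unfolding T3_def using B12 sym[of J] J_pos by (intro interior_pairing_yx[OF W]) (simp add: c_def)
      also have "\<dots> = - (\<Sum>j = 1..J. \<Sum>k = 1..K. ?r j k * (?q j k * cnj (?p j k)))"
        using sym by (simp add: c_def)
      finally show ?thesis .
    qed
    ultimately have "interior_pairing T2 W + interior_pairing T3 W = - (\<Sum>j = 1..J. \<Sum>k = 1..K.
        ?r j k * (?p j k * cnj (?q j k)) + ?r j k * (?q j k * cnj (?p j k)))"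
      by (simp only: sum.distrib minus_add_distrib)
    moreover have "Im (?r j k * (?p j k * cnj (?q j k)) + ?r j k * (?q j k * cnj (?p j k))) = 0" for j k
      by (simp del: of_real_mult add: algebra_simps)
    ultimately show ?thesis
      by (simp only: uminus_complex.sel Im_sum sum.neutral_const minus_zero)
  qed
  ultimately show ?thesis by (simp add: c0_def)
qed

end

section \<open>The discrete Gronwall argument\<close>

text \<open>  Summing up to the time level where \<open>N\<close> is largest gives
  \<open>Nmax\<^sup>2 \<le> (N 0 + (\<Sum>m = 1..M. f m)) * Nmax\<close>, as every mean of two norms is at most \<open>Nmax\<close> and \<open>\<sigma>\<close> has
  nonnegative partial sums.\<close>

lemma discrete_gronwall:
  fixes N f \<sigma> :: "nat \<Rightarrow> real"
  assumes N: "\<And>m. 0 \<le> N m" and f: "\<And>m. 0 \<le> f m"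
    and \<sigma>: "\<And>M. 0 \<le> (\<Sum>m = 1..M. \<sigma> m)"
    and step: "\<And>m. 1 \<le> m \<Longrightarrow> (N m)\<^sup>2 - (N (m - 1))\<^sup>2 \<le> f m * ((N m + N (m - 1)) / 2) - \<sigma> m"
  shows "(MAX m\<in>{0..M}. N m) \<le> N 0 + (\<Sum>m = 1..M. f m)"
proof -
  define Nmax where "Nmax = (MAX m\<in>{0..M}. N m)"
  have le: "N m \<le> Nmax" if "m \<le> M" for m
    unfolding Nmax_def using that by (intro Max_ge) auto
  have "Nmax \<in> N ` {0..M}" unfolding Nmax_def by (rule Max_in) auto
  then obtain L where L: "L \<le> M" "Nmax = N L" by auto
  have Nmax: "0 \<le> Nmax" using L N by simp
  have "(N l)\<^sup>2 - (N 0)\<^sup>2 = (\<Sum>m = 1..l. (N m)\<^sup>2 - (N (m - 1))\<^sup>2)" for l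
    by (induction l) auto
  then have "Nmax\<^sup>2 - (N 0)\<^sup>2 = (\<Sum>m = 1..L. (N m)\<^sup>2 - (N (m - 1))\<^sup>2)" by (simp add: L(2))
  also have "\<dots> \<le> (\<Sum>m = 1..L. f m * Nmax - \<sigma> m)"
  proof (rule sum_mono)
    fix m assume m: "m \<in> {1..L}"
    have "m \<le> M" "m - 1 \<le> M" using m L(1) by auto
    then have "(N m + N (m - 1)) / 2 \<le> Nmax" using le[of m] le[of "m - 1"] by simp
    then have "f m * ((N m + N (m - 1)) / 2) \<le> f m * Nmax" by (rule mult_left_mono[OF _ f])
    then show "(N m)\<^sup>2 - (N (m - 1))\<^sup>2 \<le> f m * Nmax - \<sigma> m" using step[of m] m by simp
  qed
  also have "\<dots> \<le> (\<Sum>m = 1..L. f m) * Nmax"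
    using \<sigma>[of L] by (simp add: sum_subtractf sum_distrib_right)
  also have "\<dots> \<le> (\<Sum>m = 1..M. f m) * Nmax"
    using L(1) f Nmax by (intro mult_right_mono sum_mono2) auto
  finally have "Nmax * Nmax \<le> N 0 * N 0 + (\<Sum>m = 1..M. f m) * Nmax"
    by (simp add: power2_eq_square)
  also have "\<dots> \<le> N 0 * Nmax + (\<Sum>m = 1..M. f m) * Nmax"
    using le[of 0] N by (intro add_right_mono mult_left_mono) auto
  finally have "Nmax * Nmax \<le> (N 0 + (\<Sum>m = 1..M. f m)) * Nmax" by (simp add: distrib_right)
  moreover have "0 \<le> N 0 + (\<Sum>m = 1..M. f m)" using N f by (simp add: sum_nonneg)
  ultimately have "Nmax \<le> N 0 + (\<Sum>m = 1..M. f m)"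
    using Nmax by (cases "Nmax = 0") (simp_all add: mult_le_cancel_right)
  then show ?thesis by (simp add: Nmax_def)
qed

section \<open>The splitting scheme\<close>

lemma Im_mult_of_real: "Im (z * of_real r) = Im z * r"
  by simp

lemma Im_of_real_mult: "Im (of_real r * z) = r * Im z"
  by simp

lemma Re_of_real_mult: "Re (of_real r * z) = r * Re z"
  by simp

lemma cmod_cayley_factor: "cmod (cayley_factor hbar \<tau> r dV) = 1"
proof -
  have "cmod (1 - \<i> * of_real s) = cmod (1 + \<i> * of_real s)" for s :: real
    by (simp add: cmod_def)
  moreover have "1 + \<i> * of_real s \<noteq> 0" for s :: real
    by (simp add: complex_eq_iff)
  ultimately show ?thesis by (simp add: cayley_factor_def norm_divide del: of_real_mult of_real_divide)
qed

lemma cmod_exp_factor: "cmod (exp_factor hbar \<tau> r dV) = 1"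
  by (simp add: exp_factor_def)

text \<open>  The properties of the discrete coefficients that follow from those of the coefficients: in the last
  cells and nodes they already have their exterior values.\<close>

locale scheme_mesh = exterior_mesh +
  fixes B :: "real \<Rightarrow> real \<Rightarrow> real^2^2" and \<rho> :: "real \<Rightarrow> real \<Rightarrow> real"
  assumes B_sym: "\<And>j k. j \<in> {1..J} \<Longrightarrow> k \<in> {1..K} \<Longrightarrow>
      at_cells x y (\<lambda>s t. B s t $ 1 $ 2) j k = at_cells x y (\<lambda>s t. B s t $ 2 $ 1) j k"
    and B12_last: "\<And>k. k \<in> {1..K} \<Longrightarrow> at_cells x y (\<lambda>s t. B s t $ 1 $ 2) J k = 0"
    and B11_last: "\<And>k. k \<in> {1..<K} \<Longrightarrow> along_y (shat y) (at_cells x y (\<lambda>s t. B s t $ 1 $ 1)) J k = B1_inf"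
    and \<rho>_pos: "\<And>j k. j \<in> {1..J} \<Longrightarrow> k \<in> {1..<K} \<Longrightarrow> 0 < at_nodes x y \<rho> j k"
    and \<rho>_last: "\<And>k. k \<in> {1..<K} \<Longrightarrow> at_nodes x y \<rho> J k = \<rho>_inf"
begin

abbreviation R :: "nat \<Rightarrow> nat \<Rightarrow> real" where "R \<equiv> at_nodes x y \<rho>"

definition weight :: "nat \<times> nat \<Rightarrow> real" where
  "weight = (\<lambda>(j, k). (if j < J then mid_step x j else h / 2) * mid_step y k)"

abbreviation nodes :: "(nat \<times> nat) set" where "nodes \<equiv> {1..J} \<times> {1..<K}"

definition rho_norm :: "(nat \<Rightarrow> nat \<Rightarrow> complex) \<Rightarrow> real" where
  "rho_norm U = norm_xy x J y K (\<lambda>j k. of_real (sqrt (R j k)) * U j k)"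

lemma weight_nonneg: "p \<in> nodes \<Longrightarrow> 0 \<le> weight p"
  using x_mid_pos h_pos mid_pos by (cases p) (auto simp: weight_def less_imp_le intro!: mult_nonneg_nonneg)

lemma nodes_norm_power2: "(weighted_norm nodes weight u)\<^sup>2 = (\<Sum>p\<in>nodes. weight p * (cmod (u p))\<^sup>2)"
  by (rule weighted_norm_power2) (rule weight_nonneg)

lemma sum_nodes:
  "(\<Sum>p\<in>nodes. f p) = (\<Sum>j = 1..<J. \<Sum>k = 1..<K. f (j, k)) + (\<Sum>k = 1..<K. f (J, k))"
proof -
  have "(\<Sum>p\<in>nodes. f p) = (\<Sum>j = 1..J. \<Sum>k = 1..<K. f (j, k))"
    by (simp add: sum.cartesian_product)
  moreover have "{1..J} = insert J {1..<J}" using J_pos by auto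
  ultimately show ?thesis by (simp add: add.commute)
qed

lemma inner_xy_eq:
  "inner_xy x J y K U W = (\<Sum>p\<in>nodes. case_prod U p * cnj (case_prod W p) * of_real (weight p))"
  unfolding sum_nodes by (simp add: inner_xy_def weight_def h_def)

lemma norm_xy_eq: "norm_xy x J y K U = weighted_norm nodes weight (case_prod U)"
proof -
  have "Re (inner_xy x J y K U U) = (weighted_norm nodes weight (case_prod U))\<^sup>2"
    by (simp only: inner_xy_eq nodes_norm_power2 Re_sum Re_mult_cnj_self)
  then show ?thesis by (simp add: norm_xy_def)
qed

lemma rho_norm_nonneg: "0 \<le> rho_norm U"
  by (simp add: rho_norm_def norm_xy_eq)

lemma rho_norm_power2: "(rho_norm U)\<^sup>2 = (\<Sum>p\<in>nodes. weight p * (case_prod R p * (cmod (case_prod U p))\<^sup>2))"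
  unfolding rho_norm_def norm_xy_eq nodes_norm_power2
proof (intro sum.cong refl)
  fix p assume "p \<in> nodes"
  then obtain j k where p: "p = (j, k)" "0 < R j k" using \<rho>_pos by auto
  then show "weight p * (cmod (case p of (j, k) \<Rightarrow> of_real (sqrt (R j k)) * U j k))\<^sup>2
      = weight p * (case_prod R p * (cmod (case_prod U p))\<^sup>2)"
    by (simp add: norm_mult power_mult_distrib)
qed

lemma rho_norm_cong:
  "(\<And>j k. j \<in> {1..J} \<Longrightarrow> k \<in> {1..<K} \<Longrightarrow> cmod (U j k) = cmod (W j k)) \<Longrightarrow> rho_norm U = rho_norm W"
  unfolding rho_norm_def norm_xy_eq by (intro weighted_norm_cong) (auto simp: norm_mult)

lemma rho_norm_mean_le: "rho_norm (\<lambda>j k. (U j k + W j k) / 2) \<le> (rho_norm U + rho_norm W) / 2"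
proof -
  let ?s = "\<lambda>U. case_prod (\<lambda>j k. of_real (sqrt (R j k)) * U j k)"
  have "rho_norm (\<lambda>j k. (U j k + W j k) / 2) = weighted_norm nodes weight (\<lambda>p. 1 / 2 * (?s U p + ?s W p))"
    unfolding rho_norm_def norm_xy_eq
    by (intro weighted_norm_cong arg_cong[where f = cmod]) (auto simp: algebra_simps)
  also have "\<dots> = 1 / 2 * weighted_norm nodes weight (\<lambda>p. ?s U p + ?s W p)"
    by (simp only: weighted_norm_scale) simp
  also have "\<dots> \<le> 1 / 2 * (weighted_norm nodes weight (?s U) + weighted_norm nodes weight (?s W))"
    by (intro mult_left_mono weighted_norm_triangle weight_nonneg) simp_all
  finally show ?thesis by (simp add: rho_norm_def norm_xy_eq)
qed

lemma inner_xy_le: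
  "cmod (inner_xy x J y K U W) \<le> norm_xy x J y K (\<lambda>j k. U j k / of_real (sqrt (R j k))) * rho_norm W"
proof -
  have "inner_xy x J y K U W = (\<Sum>p\<in>nodes. (case_prod (\<lambda>j k. U j k / of_real (sqrt (R j k))) p)
      * cnj (case_prod (\<lambda>j k. of_real (sqrt (R j k)) * W j k) p) * of_real (weight p))"
    unfolding inner_xy_eq
  proof (intro sum.cong refl)
    fix p assume "p \<in> nodes"
    then obtain j k where p: "p = (j, k)" "0 < R j k" using \<rho>_pos by auto
    then show "case_prod U p * cnj (case_prod W p) * of_real (weight p)
      = (case_prod (\<lambda>j k. U j k / of_real (sqrt (R j k))) p)
        * cnj (case_prod (\<lambda>j k. of_real (sqrt (R j k)) * W j k) p) * of_real (weight p)"
      by simp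
  qed
  then show ?thesis
    unfolding rho_norm_def norm_xy_eq using weighted_norm_Cauchy_Schwarz[OF weight_nonneg] by simp
qed

text \<open>  The interior equation yields the growth of the mass in the columns before \<open>J\<close> and the boundary
  equation that of the half cell at \<open>J\<close>. Both contain \<open>hbar\<^sup>2 / 2 * B1_inf * Im (dbar W, W)\<close> at \<open>x J\<close>,
  with opposite signs, and it cancels in the sum.\<close>

lemma hamiltonian_step_energy:
  fixes Pt Pb F :: "nat \<Rightarrow> nat \<Rightarrow> complex" and vt :: "nat \<Rightarrow> real" and s :: "nat \<Rightarrow> complex"
  defines "A \<equiv> \<lambda>j k. (Pt j k + Pb j k) / 2" and "D \<equiv> \<lambda>j k. (Pt j k - Pb j k) / of_real \<tau>"
  assumes Pt: "vanishes_on_Gamma J K Pt" and Pb: "vanishes_on_Gamma J K Pb"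
    and interior: "\<And>j k. j \<in> {1..<J} \<Longrightarrow> k \<in> {1..<K} \<Longrightarrow>
      \<i> * of_real (hbar * R j k) * D j k = mesh_H0 hbar x y B A j k + of_real (vt j) * A j k + F j k"
    and boundary: "\<And>k. k \<in> {1..<K} \<Longrightarrow>
      of_real (hbar\<^sup>2 / 2 * B1_inf) * along_x (dbar x) A J k
      - of_real (h / 2) * (\<i> * of_real (hbar * \<rho>_inf) * D J k
          + (of_real (hbar\<^sup>2 / 2 * B2_inf) * along_y (dhat y) (along_y (dbar y) A) J k - of_real V_inf * A J k))
      + of_real (h / 2) * F J k = of_real (hbar\<^sup>2 / 2 * B1_inf) * s k"
  shows "hbar / (2 * \<tau>) * ((rho_norm Pt)\<^sup>2 - (rho_norm Pb)\<^sup>2)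
    = Im (inner_xy x J y K F A) - hbar\<^sup>2 / 2 * B1_inf * Im (ip s (A J))"
proof -
  have A: "vanishes_on_Gamma J K A"
    using Pt Pb by (simp add: vanishes_on_Gamma_def A_def)
  define e where "e j k = hbar / (2 * \<tau>) * (R j k * ((cmod (Pt j k))\<^sup>2 - (cmod (Pb j k))\<^sup>2))" for j k
  have rate: "Im (\<i> * of_real (hbar * r) * D j k * cnj (A j k))
      = hbar / (2 * \<tau>) * (r * ((cmod (Pt j k))\<^sup>2 - (cmod (Pb j k))\<^sup>2))" for r j k
  proof -
    have "\<i> * of_real (hbar * r) * D j k * cnj (A j k)
        = \<i> * (of_real (hbar * r / \<tau>) * ((Pt j k - Pb j k) * cnj ((Pt j k + Pb j k) / 2)))"
      by (simp add: A_def D_def)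
    then have "Im (\<i> * of_real (hbar * r) * D j k * cnj (A j k))
        = hbar * r / \<tau> * Re ((Pt j k - Pb j k) * cnj ((Pt j k + Pb j k) / 2))"
      by (simp only: Im_i_times Re_of_real_mult)
    then show ?thesis unfolding Re_diff_mult_cnj_mean by simp
  qed
  have interior_sum: "(\<Sum>j = 1..<J. \<Sum>k = 1..<K. e j k * (mid_step x j * mid_step y k))
      = - (hbar\<^sup>2 / 2 * B1_inf) * Im (ip (along_x (dbar x) A J) (A J)) + Im (interior_pairing F A)"
  proof -
    have "e j k * (mid_step x j * mid_step y k)
        = Im (mesh_H0 hbar x y B A j k * cnj (A j k) * of_real (mid_step x j * mid_step y k))
          + Im (F j k * cnj (A j k) * of_real (mid_step x j * mid_step y k))"
      if jk: "j \<in> {1..<J}" "k \<in> {1..<K}" for j k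
    proof -
      have "e j k = Im ((mesh_H0 hbar x y B A j k + of_real (vt j) * A j k + F j k) * cnj (A j k))"
        unfolding e_def rate[symmetric] interior[OF jk] ..
      also have "\<dots> = Im (mesh_H0 hbar x y B A j k * cnj (A j k)) + Im (F j k * cnj (A j k))"
        by (simp add: algebra_simps)
      finally show ?thesis
        by (simp only: Im_mult_of_real distrib_right)
    qed
    then have "(\<Sum>j = 1..<J. \<Sum>k = 1..<K. e j k * (mid_step x j * mid_step y k))
        = Im (interior_pairing (mesh_H0 hbar x y B A) A) + Im (interior_pairing F A)"
      by (simp add: sum.distrib Im_sum del: times_complex.sel)
    then show ?thesis using Im_interior_pairing_H0[OF A B_sym B12_last B11_last] by simp
  qed
  have boundary_sum: "(\<Sum>k = 1..<K. e J k * (h / 2 * mid_step y k))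
      = hbar\<^sup>2 / 2 * B1_inf * Im (ip (along_x (dbar x) A J) (A J)) + h / 2 * Im (ip (F J) (A J))
        - hbar\<^sup>2 / 2 * B1_inf * Im (ip s (A J))"
  proof -
    let ?t = "transverse (hbar\<^sup>2 / 2 * B2_inf) (- V_inf) (A J)"
    let ?d = "\<lambda>k. \<i> * of_real (hbar * \<rho>_inf) * D J k"
    have "of_real (h / 2) * ip ?d (A J) = of_real (hbar\<^sup>2 / 2 * B1_inf) * ip (along_x (dbar x) A J) (A J)
        - of_real (h / 2) * ip ?t (A J) + of_real (h / 2) * ip (F J) (A J)
        - of_real (hbar\<^sup>2 / 2 * B1_inf) * ip s (A J)"
      unfolding ip_scale[symmetric] ip_add[symmetric] ip_diff[symmetric]
    proof (rule ip_cong)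
      fix k assume k: "k \<in> {1..<K}"
      have yy: "along_y (dhat y) (along_y (dbar y) A) J k = dhat y (dbar y (A J)) k"
        by (simp add: along_y_def[abs_def])
      have rearrange: "hh * d = a * X - hh * (b * L + - v * w) + hh * f - a * z"
        if "a * X - hh * (d + (b * L - v * w)) + hh * f = a * z"
        for a X hh d b L v w f z :: complex
        using that by (simp add: algebra_simps)
      show "of_real (h / 2) * ?d k = of_real (hbar\<^sup>2 / 2 * B1_inf) * along_x (dbar x) A J k
          - of_real (h / 2) * ?t k + of_real (h / 2) * F J k - of_real (hbar\<^sup>2 / 2 * B1_inf) * s k"
        unfolding transverse_def of_real_minus
        by (rule rearrange) (rule boundary[OF k, unfolded yy])
    qed simp
    moreover have "Im (ip ?t (A J)) = 0"
      using A by (intro transverse_real) (simp_all add: vanishes_on_Gamma_def)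
    moreover have "(\<Sum>k = 1..<K. e J k * (h / 2 * mid_step y k)) = h / 2 * Im (ip ?d (A J))"
      unfolding inner_y_def Im_sum sum_distrib_left
    proof (intro sum.cong refl)
      fix k assume "k \<in> {1..<K}"
      then have e: "e J k = Im (?d k * cnj (A J k))" unfolding rate e_def by (simp add: \<rho>_last)
      show "e J k * (h / 2 * mid_step y k) = h / 2 * Im (?d k * cnj (A J k) * of_real (mid_step y k))"
        unfolding Im_mult_of_real e[symmetric] by simp
    qed
    ultimately show ?thesis
      by (simp only: Im_of_real_mult[symmetric]) (simp only: minus_complex.sel plus_complex.sel Im_of_real_mult)
  qed
  have "hbar / (2 * \<tau>) * ((rho_norm Pt)\<^sup>2 - (rho_norm Pb)\<^sup>2) = (\<Sum>p\<in>nodes. case_prod e p * weight p)"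
    unfolding rho_norm_power2 sum_subtractf[symmetric] sum_distrib_left
    by (intro sum.cong refl) (auto simp: e_def algebra_simps)
  also have "\<dots> = (\<Sum>j = 1..<J. \<Sum>k = 1..<K. e j k * (mid_step x j * mid_step y k))
      + (\<Sum>k = 1..<K. e J k * (h / 2 * mid_step y k))"
    unfolding sum_nodes by (simp add: weight_def)
  also have "\<dots> = Im (interior_pairing F A) + h / 2 * Im (ip (F J) (A J))
      - hbar\<^sup>2 / 2 * B1_inf * Im (ip s (A J))"
    unfolding interior_sum boundary_sum by simp
  also have "Im (interior_pairing F A) + h / 2 * Im (ip (F J) (A J)) = Im (inner_xy x J y K F A)"
    by (simp add: inner_xy_def inner_y_def h_def Im_sum sum_distrib_left algebra_simps diff_divide_distrib)
  finally show ?thesis .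
qed

end

section \<open>Dissipativity and stability\<close>

lemma shat_const:
  fixes w :: "nat \<Rightarrow> real"
  assumes "w n = c" "w (n + 1) = c" "mid_step z n \<noteq> 0"
  shows "shat z w n = c"
proof -
  have "mesh_step z n * c + mesh_step z (n + 1) * c = c * (2 * mid_step z n)"
    by (simp add: mid_step_def field_simps)
  then show ?thesis using assms by (simp add: shat_def)
qed

lemma shat_pos:
  fixes w :: "nat \<Rightarrow> real"
  assumes "0 < w n" "0 < w (n + 1)" "0 < mesh_step z n" "0 < mesh_step z (n + 1)"
  shows "0 < shat z w n"
  using assms by (simp add: shat_def mid_step_def add_pos_pos)

theorem proposition2:
  fixes hbar \<tau> X0 X Y \<rho>_low \<rho>_inf B1_inf B2_inf V_inf :: real
    and \<rho> V :: "real \<Rightarrow> real \<Rightarrow> real"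
    and B :: "real \<Rightarrow> real \<Rightarrow> real^2^2"
    and Vt :: "real \<Rightarrow> real"
    and \<psi>0 :: "real \<Rightarrow> real \<Rightarrow> complex"
    and x y :: "nat \<Rightarrow> real"
    and J K :: nat
  assumes "hbar > 0" "\<tau> > 0" "Y > 0"
    and \<rho>_pos: "\<rho>_low > 0" "\<And>s t. 0 < s \<Longrightarrow> 0 < t \<Longrightarrow> t < Y \<Longrightarrow> \<rho> s t \<ge> \<rho>_low"
    and B_sym: "\<And>s t. 0 < s \<Longrightarrow> 0 < t \<Longrightarrow> t < Y \<Longrightarrow> transpose (B s t) = B s t"
    and B_posdef: "\<exists>\<nu>>0. \<forall>s t \<xi>. 0 < s \<and> 0 < t \<and> t < Y \<longrightarrow> \<xi> \<bullet> (B s t *v \<xi>) \<ge> \<nu> * (norm \<xi>)\<^sup>2"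
    and const_pos: "\<rho>_inf > 0" "B1_inf > 0" "B2_inf > 0"
    and "X0 > 0"
    and const_outside: "\<And>s t. s \<ge> X0 \<Longrightarrow> 0 < t \<Longrightarrow> t < Y \<Longrightarrow>
           B s t $ 1 $ 1 = B1_inf \<and> B s t $ 1 $ 2 = 0 \<and> B s t $ 2 $ 1 = 0 \<and> B s t $ 2 $ 2 = B2_inf \<and>
           \<rho> s t = \<rho>_inf \<and> V s t = V_inf \<and> \<psi>0 s t = 0"
    and Vt_outside: "\<And>s. s \<ge> X0 \<Longrightarrow> Vt s = V_inf"
    and x_mesh: "x 0 = 0" "strict_mono x" "x J = X" "X > X0" "J \<ge> 2" "x (J - 2) \<ge> X0"
           "\<And>j. j \<ge> J \<Longrightarrow> mesh_step x j = mesh_step x J"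
    and y_mesh: "y 0 = 0" "strict_mono_on {0..K} y" "y K = Y"
  shows
    "(\<forall>\<Phi> :: nat \<Rightarrow> nat \<Rightarrow> complex.
        (\<forall>k\<le>K. \<Phi> 0 k = 0) \<and> (\<forall>m. \<Phi> m 0 = 0 \<and> \<Phi> m K = 0) \<longrightarrow>
        (\<forall>M\<ge>1.
           Im (\<Sum>m = 1..M. inner_y y K (S_ref hbar \<tau> \<rho>_inf B1_inf B2_inf V_inf x J y K \<Phi> m)
                                      (\<lambda>k. sbar (\<lambda>n. \<Phi> n k) m) * of_real \<tau>) \<ge> 0))
   \<and> (\<forall>(\<Psi>0 :: nat \<Rightarrow> nat \<Rightarrow> complex) (F :: nat \<Rightarrow> nat \<Rightarrow> nat \<Rightarrow> complex)
        (E :: nat \<Rightarrow> nat \<Rightarrow> nat \<Rightarrow> complex) \<Psi>b \<Psi>t \<Psi>.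
        (\<forall>j\<le>J. \<forall>k\<le>K. \<Psi>0 j k = \<psi>0 (x j) (y k)) \<and>
        (\<forall>k\<le>K. \<Psi>0 J k = 0 \<and> \<Psi>0 (J - 1) k = 0) \<and>
        vanishes_on_Gamma J K \<Psi>0 \<and>
        (\<forall>m\<ge>1. vanishes_on_Gamma J K (F m)) \<and>
        (\<forall>m\<ge>1.
           E m = (\<lambda>j k. cayley_factor hbar \<tau> (at_nodes x y \<rho> j k) (delta_V x y V Vt j k)) \<or>
           E m = (\<lambda>j k. exp_factor hbar \<tau> (at_nodes x y \<rho> j k) (delta_V x y V Vt j k))) \<and>
        splitting_scheme hbar \<tau> x J y K \<rho> B V Vt \<rho>_inf B1_inf B2_inf V_inf
          (S_ref hbar \<tau> \<rho>_inf B1_inf B2_inf V_inf x J y K) \<Psi>0 F E \<Psi>b \<Psi>t \<Psi> \<longrightarrow>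
        (\<forall>M\<ge>1.
           (MAX m\<in>{0..M}. norm_xy x J y K (\<lambda>j k. of_real (sqrt (at_nodes x y \<rho> j k)) * \<Psi> m j k))
           \<le> norm_xy x J y K (\<lambda>j k. of_real (sqrt (at_nodes x y \<rho> j k)) * \<Psi>0 j k)
             + 2 / hbar * (\<Sum>m = 1..M.
                 norm_xy x J y K (\<lambda>j k. F m j k / of_real (sqrt (at_nodes x y \<rho> j k))) * \<tau>)))"
  (is "?dissipative \<and> ?stable")
proof -
  have K: "1 \<le> K" using y_mesh \<open>Y > 0\<close> by (cases K) auto
  interpret exterior_mesh y K hbar \<tau> \<rho>_inf B1_inf B2_inf V_inf x J
  proof unfold_locales
    show "mesh_step x j = mesh_step x J" if "J \<le> j" for j
      using that by (rule x_mesh(7))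
  qed (fact | use \<open>J \<ge> 2\<close> in simp)+
  have x_cell_pos: "0 < sbar x j" if "1 \<le> j" for j
    using strict_mono_less[OF x_mesh(2), of 0 j] strict_mono_less_eq[OF x_mesh(2), of 0 "j - 1"]
      x_mesh(1) that by (simp add: sbar_def)
  have x_cell_outside: "X0 \<le> sbar x j" if "J - 1 \<le> j" for j
  proof -
    have "x (J - 2) \<le> x (j - 1)" "x (J - 2) \<le> x j"
      using that by (simp_all add: strict_mono_less_eq[OF x_mesh(2)])
    then show ?thesis using x_mesh(6) by (simp add: sbar_def)
  qed
  have y_cell: "0 < sbar y k" "sbar y k < Y" if "k \<in> {1..K}" for k
  proof -
    have "y 0 \<le> y (k - 1)" "y (k - 1) < y k" "y k \<le> y K"
      using that strict_mono_on_leD[OF y_mesh(2)] strict_mono_onD[OF y_mesh(2)] by auto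
    then show "0 < sbar y k" "sbar y k < Y" using y_mesh by (auto simp: sbar_def)
  qed
  have cell_const: "at_cells x y A j k = c"
    if "\<And>s t. s \<ge> X0 \<Longrightarrow> 0 < t \<Longrightarrow> t < Y \<Longrightarrow> A s t = c" "J - 1 \<le> j" "k \<in> {1..K}" for A c j k
    unfolding at_cells_def using that x_cell_outside y_cell by blast
  have node_const: "at_nodes x y A J k = c"
    if A: "\<And>s t. s \<ge> X0 \<Longrightarrow> 0 < t \<Longrightarrow> t < Y \<Longrightarrow> A s t = c" and k: "k \<in> {1..<K}" for A c k
  proof -
    have "along_y (shat y) (at_cells x y A) j k = c" if "J - 1 \<le> j" for j
      unfolding along_y_def using k that mid_pos[OF k]
      by (intro shat_const cell_const[OF A]) auto
    then show ?thesis
      unfolding at_nodes_def along_x_def using x_mid_pos[of J] \<open>J \<ge> 2\<close>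
      by (intro shat_const) auto
  qed
  have \<rho>_node: "0 < at_nodes x y \<rho> j k" if jk: "j \<in> {1..J}" "k \<in> {1..<K}" for j k
  proof -
    have "0 < at_cells x y \<rho> i l" if "1 \<le> i" "l \<in> {1..K}" for i l
      unfolding at_cells_def using \<rho>_pos(1) \<rho>_pos(2)[OF x_cell_pos[OF that(1)] y_cell[OF that(2)]]
      by linarith
    then have "0 < along_y (shat y) (at_cells x y \<rho>) i k" if "1 \<le> i" for i
      unfolding along_y_def using jk that step_pos by (intro shat_pos) auto
    then show ?thesis
      unfolding at_nodes_def along_x_def using jk x_step_pos by (intro shat_pos) auto
  qed
  interpret scheme_mesh y K hbar \<tau> \<rho>_inf B1_inf B2_inf V_inf x J B \<rho>
  proof unfold_locales
    show "at_cells x y (\<lambda>s t. B s t $ 1 $ 2) j k = at_cells x y (\<lambda>s t. B s t $ 2 $ 1) j k"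
      if "j \<in> {1..J}" "k \<in> {1..K}" for j k
    proof -
      have "transpose (B (sbar x j) (sbar y k)) = B (sbar x j) (sbar y k)"
        using that by (intro B_sym x_cell_pos y_cell) auto
      then have "transpose (B (sbar x j) (sbar y k)) $ 2 $ 1 = B (sbar x j) (sbar y k) $ 2 $ 1" by simp
      then show ?thesis by (simp add: at_cells_def transpose_def)
    qed
    show "at_cells x y (\<lambda>s t. B s t $ 1 $ 2) J k = 0" if "k \<in> {1..K}" for k
      using that const_outside by (intro cell_const) auto
    show "along_y (shat y) (at_cells x y (\<lambda>s t. B s t $ 1 $ 1)) J k = B1_inf" if "k \<in> {1..<K}" for k
      unfolding along_y_def using that const_outside mid_pos[OF that]
      by (intro shat_const cell_const) auto
    show "at_nodes x y \<rho> J k = \<rho>_inf" if "k \<in> {1..<K}" for k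
      using that const_outside by (intro node_const) auto
  qed (rule \<rho>_node)
  have dV: "delta_V x y V Vt J k = 0" if "k \<in> {1..<K}" for k
  proof -
    have "at_nodes x y V J k = V_inf" using that const_outside by (intro node_const) auto
    moreover have "at_nodes_1d x Vt J = V_inf"
      unfolding at_nodes_1d_def using x_mid_pos[of J] \<open>J \<ge> 2\<close>
      by (intro shat_const Vt_outside x_cell_outside) auto
    ultimately show ?thesis by (simp add: delta_V_def)
  qed
  have dissipative: ?dissipative
  proof (intro allI impI)
    fix \<Phi> :: "nat \<Rightarrow> nat \<Rightarrow> complex" and M :: nat
    assume "(\<forall>k\<le>K. \<Phi> 0 k = 0) \<and> (\<forall>m. \<Phi> m 0 = 0 \<and> \<Phi> m K = 0)"
    then have "0 \<le> (\<Sum>m = 1..M. Im (ip (S \<Phi> m) (\<lambda>k. sbar (\<lambda>n. \<Phi> n k) m)))"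
      by (intro S_dissipative) auto
    then show "0 \<le> Im (\<Sum>m = 1..M. ip (S \<Phi> m) (\<lambda>k. sbar (\<lambda>n. \<Phi> n k) m) * of_real \<tau>)"
      using \<open>\<tau> > 0\<close> by (simp only: Im_sum Im_mult_of_real sum_distrib_right[symmetric]) simp
  qed
  have stable: ?stable
  proof (intro allI impI, elim conjE)
    fix \<Psi>0 :: "nat \<Rightarrow> nat \<Rightarrow> complex" and F E \<Psi>b \<Psi>t \<Psi> :: "nat \<Rightarrow> nat \<Rightarrow> nat \<Rightarrow> complex" and M :: nat
    assume \<Psi>0_last: "\<forall>k\<le>K. \<Psi>0 J k = 0 \<and> \<Psi>0 (J - 1) k = 0"
      and E: "\<forall>m\<ge>1.
           E m = (\<lambda>j k. cayley_factor hbar \<tau> (at_nodes x y \<rho> j k) (delta_V x y V Vt j k)) \<or>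
           E m = (\<lambda>j k. exp_factor hbar \<tau> (at_nodes x y \<rho> j k) (delta_V x y V Vt j k))"
      and scheme: "splitting_scheme hbar \<tau> x J y K \<rho> B V Vt \<rho>_inf B1_inf B2_inf V_inf S \<Psi>0 F E \<Psi>b \<Psi>t \<Psi>"
    define A where "A m j k = (\<Psi>t m j k + \<Psi>b m j k) / 2" for m j k
    define s where "s = S (\<lambda>n. \<Psi>t n J)"
    have \<Psi>_init: "\<Psi> 0 j k = \<Psi>0 j k" if "j \<le> J" "k \<le> K" for j k
      using scheme that unfolding splitting_scheme_def by blast
    note at_time = scheme[unfolded splitting_scheme_def Let_def, THEN conjunct2, rule_format]
    have half1: "\<Psi>b m j k = E m j k * \<Psi> (m - 1) j k"
      and half2: "\<Psi> m j k = E m j k * \<Psi>t m j k"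
      if "1 \<le> m" "j \<in> {1..J}" "k \<in> {1..<K}" for m j k
      using at_time[OF that(1)] that(2,3) by blast+
    have \<Psi>t_edge: "vanishes_on_Gamma J K (\<Psi>t m)" if "1 \<le> m" for m
      using at_time[OF that] by blast
    have E_unimodular: "cmod (E m j k) = 1" if "1 \<le> m" for m j k
    proof -
      have "E m = (\<lambda>j k. cayley_factor hbar \<tau> (at_nodes x y \<rho> j k) (delta_V x y V Vt j k)) \<or>
           E m = (\<lambda>j k. exp_factor hbar \<tau> (at_nodes x y \<rho> j k) (delta_V x y V Vt j k))"
        using E that by blast
      then show ?thesis by (elim disjE) (simp_all only: cmod_cayley_factor cmod_exp_factor)
    qed
    have E_last: "E m J k = 1" if "1 \<le> m" "k \<in> {1..<K}" for m k
    proof -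
      have "E m = (\<lambda>j k. cayley_factor hbar \<tau> (at_nodes x y \<rho> j k) (delta_V x y V Vt j k)) \<or>
           E m = (\<lambda>j k. exp_factor hbar \<tau> (at_nodes x y \<rho> j k) (delta_V x y V Vt j k))"
        using E that by blast
      then show ?thesis by (elim disjE) (simp_all add: cayley_factor_def exp_factor_def dV[OF that(2)])
    qed
    have rho_norm_b: "rho_norm (\<Psi>b m) = rho_norm (\<Psi> (m - 1))" and rho_norm_t: "rho_norm (\<Psi>t m) = rho_norm (\<Psi> m)" if "1 \<le> m" for m
      using that half1 half2 E_unimodular by (auto intro!: rho_norm_cong simp: norm_mult)
    \<comment> \<open>The scheme feeds \<open>S_ref\<close> with \<open>\<Psi>t\<close>, but \<open>A m J\<close> averages \<open>\<Psi>t m\<close> and \<open>\<Psi>b m\<close>. As the potential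
      half-steps are trivial in column \<open>J\<close>, \<open>\<Psi>b m\<close> equals \<open>\<Psi>t (m - 1)\<close> there, or zero if \<open>m = 1\<close>.\<close>
    have absorbed: "0 \<le> (\<Sum>m = 1..L. Im (ip (s m) (A m J)))" for L
    proof -
      define \<Phi> where "\<Phi> n = (if n = 0 then (\<lambda>k. 0) else \<Psi>t n J)" for n
      have "s = S \<Phi>" unfolding s_def by (rule S_ignores_initial) (simp add: \<Phi>_def)
      moreover have "A m J k = sbar (\<lambda>n. \<Phi> n k) m" if m: "1 \<le> m" and k: "k \<in> {1..<K}" for m k
      proof -
        have "\<Psi>b m J k = \<Psi> (m - 1) J k" using half1[OF m _ k] E_last[OF m k] J_pos by simp
        also have "\<dots> = \<Phi> (m - 1) k"
        proof (cases "m = 1")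
          case True
          then show ?thesis using \<Psi>_init[of J k] \<Psi>0_last k by (simp add: \<Phi>_def)
        next
          case False
          then show ?thesis using half2[of "m - 1" J k] E_last[of "m - 1" k] m k J_pos by (simp add: \<Phi>_def)
        qed
        finally show ?thesis using m by (simp add: A_def sbar_def \<Phi>_def add.commute)
      qed
      ultimately have "(\<Sum>m = 1..L. Im (ip (s m) (A m J)))
          = (\<Sum>m = 1..L. Im (ip (S \<Phi> m) (\<lambda>k. sbar (\<lambda>n. \<Phi> n k) m)))"
        by (intro sum.cong refl arg_cong[where f = Im] ip_cong) auto
      moreover have "\<Phi> m 0 = 0 \<and> \<Phi> m K = 0" if "1 \<le> m" for m
        using vanishes_on_GammaD[OF \<Psi>t_edge[OF that], of J] that by (simp add: \<Phi>_def)
      ultimately show ?thesis using S_dissipative[of \<Phi> L] by (simp add: \<Phi>_def)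
    qed
    define N where "N m = rho_norm (\<Psi> m)" for m
    define f where "f m = 2 / hbar * (norm_xy x J y K (\<lambda>j k. F m j k / of_real (sqrt (R j k))) * \<tau>)" for m
    define \<sigma> where "\<sigma> m = \<tau> * hbar * B1_inf * Im (ip (s m) (A m J))" for m
    have step: "(N m)\<^sup>2 - (N (m - 1))\<^sup>2 \<le> f m * ((N m + N (m - 1)) / 2) - \<sigma> m" if m: "1 \<le> m" for m
    proof -
      have "hbar / (2 * \<tau>) * ((rho_norm (\<Psi>t m))\<^sup>2 - (rho_norm (\<Psi>b m))\<^sup>2)
          = Im (inner_xy x J y K (F m) (A m)) - hbar\<^sup>2 / 2 * B1_inf * Im (ip (s m) (A m J))"
        unfolding A_def
        by (rule hamiltonian_step_energy[where vt = "at_nodes_1d x Vt"])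
           (use at_time[OF m] in \<open>simp_all only: s_def h_def ball_simps conj_assoc\<close>)
      then have balance: "(N m)\<^sup>2 - (N (m - 1))\<^sup>2 = 2 * \<tau> / hbar * Im (inner_xy x J y K (F m) (A m)) - \<sigma> m"
        using hbar \<tau> unfolding rho_norm_b[OF m] rho_norm_t[OF m] N_def \<sigma>_def
        by (simp add: field_simps power2_eq_square)
      define G where "G = norm_xy x J y K (\<lambda>j k. F m j k / of_real (sqrt (R j k)))"
      have "Im (inner_xy x J y K (F m) (A m)) \<le> cmod (inner_xy x J y K (F m) (A m))"
        using abs_Im_le_cmod abs_le_D1 by blast
      also have "\<dots> \<le> G * rho_norm (A m)" unfolding G_def by (rule inner_xy_le)
      also have "\<dots> \<le> G * ((N m + N (m - 1)) / 2)"
        using rho_norm_mean_le[of "\<Psi>t m" "\<Psi>b m"]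
        unfolding A_def[abs_def] rho_norm_b[OF m] rho_norm_t[OF m] N_def
        by (intro mult_left_mono) (simp_all add: G_def norm_xy_eq)
      finally have "2 * \<tau> / hbar * Im (inner_xy x J y K (F m) (A m))
          \<le> 2 * \<tau> / hbar * (G * ((N m + N (m - 1)) / 2))"
        using hbar \<tau> by (intro mult_left_mono) simp_all
      also have "\<dots> = f m * ((N m + N (m - 1)) / 2)" by (simp add: f_def G_def)
      finally show ?thesis unfolding balance by simp
    qed
    have "(MAX m\<in>{0..M}. N m) \<le> N 0 + (\<Sum>m = 1..M. f m)"
    proof (rule discrete_gronwall[where \<sigma> = \<sigma>])
      show "0 \<le> N m" for m by (simp add: N_def rho_norm_nonneg)
      show "0 \<le> f m" for m using hbar \<tau> by (simp add: f_def norm_xy_eq)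
      show "0 \<le> (\<Sum>m = 1..L. \<sigma> m)" for L
        using absorbed[of L] hbar \<tau> B1_inf by (simp add: \<sigma>_def sum_distrib_left[symmetric])
    qed (rule step)
    moreover have "N 0 = rho_norm \<Psi>0"
      unfolding N_def using \<Psi>_init by (intro rho_norm_cong) simp
    ultimately show "(MAX m\<in>{0..M}. norm_xy x J y K (\<lambda>j k. of_real (sqrt (at_nodes x y \<rho> j k)) * \<Psi> m j k))
           \<le> norm_xy x J y K (\<lambda>j k. of_real (sqrt (at_nodes x y \<rho> j k)) * \<Psi>0 j k)
             + 2 / hbar * (\<Sum>m = 1..M.
                 norm_xy x J y K (\<lambda>j k. F m j k / of_real (sqrt (at_nodes x y \<rho> j k))) * \<tau>)"
      by (simp only: N_def f_def rho_norm_def sum_distrib_left)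
  qed
  show ?thesis using dissipative stable by blast
qed

end
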